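(* Let $A=\mathbb{C}[x_1,x_2,\dots]$ be the polynomial ring in countably many variables, $x_i$ of degree $i$, and let $d:A\to A$ be the derivation determined by $dx_1=0$ and $dx_i=x_{i-1}$ for $i>1$. Let $J=\mathrm{Ker}(d)\subset A$ (a subring, the ring of Atiyah–Segal invariant polynomials). Let $J'$ be the $\mathbb{C}$-vector space with basis the set $B(0)=\bigcup_{\ell\ge 0}B^{(\ell)}(0)$, equipped with the bilinear product defined on basis elements $\beta\in B^{(\ell)}(0)$, $\beta'\in B^{(\ell')}(0)$ by $$\beta\cdot\beta'=\sum_{\beta''\in B^{(\ell+\ell')}(0)} N^{\beta''}_{\beta\beta'}\,\beta''.$$ Then $J$ is isomorphic as a ring to $J'$.
   Context: For an integer $\ell\ge 1$, $B^{(\ell)}=\{\beta=(\beta_1,\dots,\beta_\ell)\in\mathbb{Z}^\ell : \beta_1,\dots,\beta_{\ell-1}\ge 0,\ \beta_\ell\ge 1\}$, and $B^{(0)}=\{(\emptyset)\}$ (a single element, the empty tuple). The subsets $B^{(\ell)}(0)\subset B^{(\ell)}$ are: $B^{(0)}(0)=B^{(0)}$; $B^{(1)}(0)=\{(1)\}$; and for $\ell>1$, $B^{(\ell)}(0)=\{\beta\in B^{(\ell)}:\beta_1=0\}$. For variables $\vec k=(k_1,\dots,k_\ell)$, $\vec k'=(k'_1,\dots,k'_{\ell'})$, let $e_i(\vec k)$, $e_i(\vec k')$, $e_i(\vec k,\vec k')$ denote the $i$-th elementary symmetric polynomials in $\{k_1,\dots,k_\ell\}$, $\{k'_1,\dots,k'_{\ell'}\}$,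 and $\{k_1,\dots,k_\ell,k'_1,\dots,k'_{\ell'}\}$ respectively. For $\beta\in B^{(\ell)}$, $\beta'\in B^{(\ell')}$, $\beta''\in B^{(\ell+\ell')}$, the non-negative integers $N^{\beta''}_{\beta\beta'}$ are defined by the polynomial identity $$e_1(\vec k,\vec k')^{\beta''_1}\cdots e_{\ell+\ell'}(\vec k,\vec k')^{\beta''_{\ell+\ell'}}=\sum_{\beta\in B^{(\ell)},\ \beta'\in B^{(\ell')}} N^{\beta''}_{\beta\beta'}\, e_1(\vec k)^{\beta_1}\cdots e_\ell(\vec k)^{\beta_\ell}\, e_1(\vec k')^{\beta'_1}\cdots e_{\ell'}(\vec k')^{\beta'_{\ell'}}.$$ *)

theory Defs
  imports Complex_Main "HOL-Library.Poly_Mapping"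
begin

text \<open>Polynomials in countably many variables: finitely supported maps from
 monomials (finitely supported exponent vectors nat =>0 nat) to complex.
 Variable index k (k = 0,1,2,...) stands for x_(k+1).\<close>

type_synonym Apoly = "(nat \<Rightarrow>\<^sub>0 nat) \<Rightarrow>\<^sub>0 complex"

text \<open>The derivation with d x_1 = 0, d x_i = x_(i-1): on a monomial m it gives
 sum over variables i (index >= 1) of m_i * m / x_i * x_(i-1), extended linearly.\<close>

definition dmon :: "(nat \<Rightarrow>\<^sub>0 nat) \<Rightarrow> Apoly" where
  "dmon m = (\<Sum>i\<in>Poly_Mapping.keys m.
      if i = 0 then 0
      else Poly_Mapping.single (m - Poly_Mapping.single i 1 + Poly_Mapping.single (i - 1) 1)
             (of_nat (Poly_Mapping.lookup m i)))"

definition dA :: "Apoly \<Rightarrow> Apoly" where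
  "dA p = (\<Sum>m\<in>Poly_Mapping.keys p. Poly_Mapping.single 0 (Poly_Mapping.lookup p m) * dmon m)"

definition Jring :: "Apoly set" where
  "Jring = {p. dA p = 0}"

definition Bset :: "nat \<Rightarrow> nat list set" where
  "Bset l = (if l = 0 then {[]} else {b. length b = l \<and> b ! (l - 1) \<ge> 1})"

definition B0set :: "nat \<Rightarrow> nat list set" where
  "B0set l = (if l = 0 then {[]} else if l = 1 then {[1]} else {b \<in> Bset l. b ! 0 = 0})"

definition B0 :: "nat list set" where
  "B0 = (\<Union>l. B0set l)"

text \<open>Variables k_(i+1) are Inl i, variables k'_(j+1) are Inr j; integer polynomials.\<close>

type_synonym Kpoly = "((nat + nat) \<Rightarrow>\<^sub>0 nat) \<Rightarrow>\<^sub>0 int"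

definition esym :: "(nat + nat) set \<Rightarrow> nat \<Rightarrow> Kpoly" where
  "esym V i = (\<Sum>S\<in>{S. S \<subseteq> V \<and> card S = i}.
      Poly_Mapping.single (\<Sum>v\<in>S. Poly_Mapping.single v 1) 1)"

definition emon :: "(nat + nat) set \<Rightarrow> nat list \<Rightarrow> Kpoly" where
  "emon V b = (\<Prod>i<length b. esym V (i + 1) ^ (b ! i))"

definition kvars :: "nat \<Rightarrow> (nat + nat) set" where
  "kvars l = Inl ` {..<l}"

definition kpvars :: "nat \<Rightarrow> (nat + nat) set" where
  "kpvars l = Inr ` {..<l}"

text \<open>Ncoef l l' b'' is the (unique) finitely supported coefficient function on
 B^(l) x B^(l') expressing e(k,k')^b'' in the basis e(k)^b e(k')^b'.\<close>

definition Ncoef :: "nat \<Rightarrow> nat \<Rightarrow> nat list \<Rightarrow> (nat list \<times> nat list \<Rightarrow> int)" where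
  "Ncoef l l' b'' = (THE f.
      (\<forall>b b'. f (b, b') \<noteq> 0 \<longrightarrow> b \<in> Bset l \<and> b' \<in> Bset l') \<and>
      finite {q. f q \<noteq> 0} \<and>
      emon (kvars l \<union> kpvars l') b'' =
        (\<Sum>q\<in>{q. f q \<noteq> 0}. of_int (f q) * emon (kvars l) (fst q) * emon (kpvars l') (snd q)))"

definition Nco :: "nat list \<Rightarrow> nat list \<Rightarrow> nat list \<Rightarrow> int" where
  "Nco b b' b'' = Ncoef (length b) (length b') b'' (b, b')"

definition Jprime :: "(nat list \<Rightarrow>\<^sub>0 complex) set" where
  "Jprime = {a. Poly_Mapping.keys a \<subseteq> B0}"

definition mulJ :: "(nat list \<Rightarrow>\<^sub>0 complex) \<Rightarrow> (nat list \<Rightarrow>\<^sub>0 complex) \<Rightarrow> (nat list \<Rightarrow>\<^sub>0 complex)" where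
  "mulJ a c = Abs_poly_mapping (\<lambda>b''.
      \<Sum>b\<in>Poly_Mapping.keys a. \<Sum>b'\<in>Poly_Mapping.keys c.
        if b'' \<in> B0set (length b + length b')
        then Poly_Mapping.lookup a b * Poly_Mapping.lookup c b' * of_int (Nco b b' b'') else 0)"

end

theory Submission
  imports Defs "HOL-Combinatorics.Permutations"
begin

text \<open>
  The monomial \<open>x_(a1) ... x_(al)\<close> defines the functional ``coefficient of
  \<open>k_1^a1 ... k_l^al\<close>'' on symmetric polynomials in \<open>l\<close> variables that are divisible by
  \<open>e_l\<close>. Under this pairing \<open>d\<close> is adjoint to multiplication by \<open>e_1\<close>, and multiplication in
  \<open>A\<close> is adjoint to splitting the variables into two groups. For the weight
  \<open>sum_j (j + 1) a_j\<close> every \<open>e^\<beta>\<close> has a unique exponent of minimal weight, with coefficient 1, and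
  each monomial of \<open>A\<close> arises from exactly one of these leading exponents; so the pairing is
  unitriangular and \<open>p \<mapsto> (\<langle>p, e^\<beta>\<rangle>)_\<beta>\<close> is a bijection from \<open>A\<close> to the span of all
  \<open>\<beta>\<close>. The kernel of \<open>d\<close> consists of the \<open>p\<close> that annihilate every multiple of \<open>e_1\<close>, which means
  that only the \<open>\<beta>\<close> in \<open>B(0)\<close> survive, and the structure constants of the product
  become the numbers \<open>N\<close>.
\<close>

subsection \<open>Finitely supported maps and elementary symmetric polynomials\<close>

abbreviation lookup :: "('a \<Rightarrow>\<^sub>0 'b::zero) \<Rightarrow> 'a \<Rightarrow> 'b" where
  "lookup \<equiv> Poly_Mapping.lookup"
abbreviation keys :: "('a \<Rightarrow>\<^sub>0 'b::zero) \<Rightarrow> 'a set" where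
  "keys \<equiv> Poly_Mapping.keys"
abbreviation single :: "'a \<Rightarrow> 'b::zero \<Rightarrow> 'a \<Rightarrow>\<^sub>0 'b" where
  "single \<equiv> Poly_Mapping.single"

text \<open>Serves two purposes: with complex values it extends the pairing linearly from monomials
  to \<open>Apoly\<close>, and with natural values it gives the weight \<open>wt\<close> of an
  exponent.\<close>

definition lin_ext :: "('a \<Rightarrow> 'b::comm_semiring_1) \<Rightarrow> ('a \<Rightarrow>\<^sub>0 'b) \<Rightarrow> 'b" where
  "lin_ext f p = (\<Sum>m\<in>keys p. lookup p m * f m)"

lemma lin_ext_superset:
  assumes "finite A" "keys p \<subseteq> A"
  shows "lin_ext f p = (\<Sum>m\<in>A. lookup p m * f m)"
  unfolding lin_ext_def using assms
  by (intro sum.mono_neutral_left) (auto simp: in_keys_iff)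

lemma lin_ext_add: "lin_ext f (p + q) = lin_ext f p + lin_ext f q"
proof -
  let ?A = "keys p \<union> keys q"
  have "lin_ext f (p + q) = (\<Sum>m\<in>?A. lookup (p + q) m * f m)"
    by (rule lin_ext_superset) (use keys_add[of p q] in auto)
  also have "\<dots> = lin_ext f p + lin_ext f q"
    by (simp add: lookup_add ring_distribs sum.distrib lin_ext_superset[of ?A])
  finally show ?thesis .
qed

lemma lin_ext_zero [simp]: "lin_ext f 0 = 0"
  by (simp add: lin_ext_def)

lemma lin_ext_sum: "lin_ext f (sum g S) = (\<Sum>s\<in>S. lin_ext f (g s))"
  by (induction S rule: infinite_finite_induct) (auto simp: lin_ext_add)

lemma lin_ext_single [simp]: "lin_ext f (single m c) = c * f m"
  by (simp add: lin_ext_superset[of "{m}"])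

lemma poly_mapping_sum_single: "(\<Sum>m\<in>keys p. single m (lookup p m)) = p"
  by (rule poly_mapping_eqI)
     (auto simp: lookup_sum lookup_single when_def in_keys_iff)

lemma poly_mapping_mult_expand:
  "p * q = (\<Sum>m\<in>keys p. \<Sum>m'\<in>keys q. single (m + m') (lookup p m * lookup q m'))"
proof -
  have "p * q = (\<Sum>m\<in>keys p. single m (lookup p m)) * (\<Sum>m\<in>keys q. single m (lookup q m))"
    by (simp add: poly_mapping_sum_single)
  then show ?thesis
    by (simp add: sum_product mult_single)
qed

lemma lin_ext_mult:
  "lin_ext f (p * q) = (\<Sum>m\<in>keys p. \<Sum>m'\<in>keys q. lookup p m * lookup q m' * f (m + m'))"
  by (subst poly_mapping_mult_expand) (simp add: lin_ext_sum)

lemma lookup_mult_expand: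
  "lookup (p * q) n = (\<Sum>m\<in>keys p. \<Sum>m'\<in>keys q. if m + m' = n then lookup p m * lookup q m' else 0)"
  by (subst poly_mapping_mult_expand) (simp add: lookup_sum lookup_single when_def)

lemma lookup_single_mult_add [simp]:
  fixes k :: "'a::cancel_comm_monoid_add" and c :: "'b::comm_ring_1"
  shows "lookup (single k c * f) (k + l) = c * lookup f l"
proof -
  have "single k c * f = (\<Sum>m\<in>keys f. single (k + m) (c * lookup f m))"
    by (subst (1) poly_mapping_sum_single[symmetric]) (simp add: sum_distrib_left mult_single)
  then show ?thesis
    by (auto simp: lookup_sum lookup_single when_def in_keys_iff)
qed

lemma lookup_single_mult_nonzero:
  fixes k :: "'a::cancel_comm_monoid_add" and c :: "'b::comm_ring_1"
  assumes "lookup (single k c * f) n \<noteq> 0"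
  shows "\<exists>l. n = k + l"
  using keys_mult[of "single k c" f] assms
  by (auto simp: in_keys_iff split: if_splits)

section \<open>Squarefree monomials and multiplication by elementary symmetric polynomials\<close>

definition ind :: "'v set \<Rightarrow> 'v \<Rightarrow>\<^sub>0 nat" where
  "ind S = (\<Sum>v\<in>S. single v 1)"

lemma lookup_ind: "finite S \<Longrightarrow> lookup (ind S) v = (if v \<in> S then 1 else 0)"
  by (simp add: ind_def lookup_sum lookup_single when_def)

lemma esym_eq: "esym V i = (\<Sum>S | S \<subseteq> V \<and> card S = i. single (ind S) 1)"
  by (simp add: esym_def ind_def)

text \<open>Multiplying by a squarefree monomial shifts exponents by \<open>ind S\<close>. The
  subtraction is truncated, so it undoes the shift only if every variable of \<open>S\<close> occurs
  in \<open>\<kappa>\<close>; otherwise no term can land on \<open>\<kappa>\<close>.\<close>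

lemma lookup_ind_mult:
  fixes f :: "('v \<Rightarrow>\<^sub>0 nat) \<Rightarrow>\<^sub>0 'b::comm_ring_1"
  assumes "finite S"
  shows "lookup (single (ind S) 1 * f) \<kappa> = (if S \<subseteq> keys \<kappa> then lookup f (\<kappa> - ind S) else 0)"
proof (cases "S \<subseteq> keys \<kappa>")
  case True
  have "\<kappa> = ind S + (\<kappa> - ind S)"
    using True assms
    by (intro poly_mapping_eqI)
       (force simp: lookup_add lookup_minus lookup_ind in_keys_iff subset_iff)
  then have "lookup (single (ind S) 1 * f) \<kappa> = lookup (single (ind S) 1 * f) (ind S + (\<kappa> - ind S))"
    by simp
  with True show ?thesis by (simp del: add_diff_cancel_left')
next
  case False
  have "\<not> (\<exists>l. \<kappa> = ind S + l)"
    using False assms by (auto simp: lookup_add lookup_ind in_keys_iff subset_iff)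
  with False show ?thesis using lookup_single_mult_nonzero[of "ind S" "1::'b" f \<kappa>] by auto
qed

lemma lookup_esym_mult:
  assumes "finite V"
  shows "lookup (esym V i * f) \<kappa> =
    (\<Sum>S | S \<subseteq> V \<and> card S = i. if S \<subseteq> keys \<kappa> then lookup f (\<kappa> - ind S) else 0)"
proof -
  have "lookup (single (ind S) 1 * f) \<kappa> = (if S \<subseteq> keys \<kappa> then lookup f (\<kappa> - ind S) else 0)"
    if "S \<subseteq> V" for S
    using that assms by (intro lookup_ind_mult) (auto intro: finite_subset)
  then show ?thesis
    by (simp add: esym_eq sum_distrib_right lookup_sum)
qed

text \<open>Builds \<open>emon\<close> by multiplying with one \<open>esym\<close> at a time.
  Running two variable sets in parallel covers comparisons between them; invariants of a single set
  are obtained by letting \<open>Q\<close> ignore its second argument.\<close>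

lemma emon_rel_induct:
  assumes "length b = n" and base: "Q 1 1"
    and step: "\<And>i f f'. i < n \<Longrightarrow> Q f f' \<Longrightarrow> Q (esym V (Suc i) * f) (esym V' (Suc i) * f')"
  shows "Q (emon V b) (emon V' b)"
proof -
  have power: "Q (esym V (Suc i) ^ k * f) (esym V' (Suc i) ^ k * f')" if "i < n" "Q f f'" for i k f f'
    using that by (induction k) (auto simp: mult.assoc intro: step)
  have "Q (\<Prod>i<k. esym V (Suc i) ^ (b ! i)) (\<Prod>i<k. esym V' (Suc i) ^ (b ! i))" if "k \<le> n" for k
    using that
  proof (induction k)
    case 0 show ?case using base by simp
  next
    case (Suc k)
    then show ?case using power[of k _ _ "b ! k"]
      by (simp add: mult.commute[of _ "esym _ (Suc k) ^ _"])
  qed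
  then show ?thesis using assms(1) by (simp add: emon_def)
qed

section \<open>Symmetry under renaming of variables\<close>

definition related :: "('v \<Rightarrow> 'w) \<Rightarrow> 'v set \<Rightarrow> 'w set \<Rightarrow> ('v \<Rightarrow>\<^sub>0 nat) \<Rightarrow> ('w \<Rightarrow>\<^sub>0 nat) \<Rightarrow> bool" where
  "related h V V' \<kappa> \<kappa>' \<longleftrightarrow> keys \<kappa> \<subseteq> V \<and> keys \<kappa>' \<subseteq> V' \<and> (\<forall>v\<in>V. lookup \<kappa> v = lookup \<kappa>' (h v))"

lemma related_minus_ind:
  assumes "related h V V' \<kappa> \<kappa>'" "bij_betw h V V'" "S \<subseteq> V" "finite V"
  shows "related h V V' (\<kappa> - ind S) (\<kappa>' - ind (h ` S))"
proof -
  have "finite S" using assms finite_subset by auto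
  moreover have "v \<in> S \<longleftrightarrow> h v \<in> h ` S" if "v \<in> V" for v
    using that assms by (auto simp: bij_betw_def inj_on_def)
  moreover have "finite (h ` S)" using \<open>finite S\<close> by simp
  ultimately show ?thesis using assms(1) 
    unfolding related_def in_keys_iff subset_iff
    by (fastforce simp: lookup_minus lookup_ind)
qed

lemma related_subset_keys:
  assumes "related h V V' \<kappa> \<kappa>'" "S \<subseteq> V"
  shows "h ` S \<subseteq> keys \<kappa>' \<longleftrightarrow> S \<subseteq> keys \<kappa>"
  using assms by (auto simp: related_def in_keys_iff subset_iff)

lemma bij_betw_card_subsets:
  assumes "bij_betw h V V'"
  shows "bij_betw ((`) h) {S. S \<subseteq> V \<and> card S = i} {S. S \<subseteq> V' \<and> card S = i}"
proof -
  have "bij_betw ((`) h) (Pow V) (Pow V')"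
    using assms by (rule bij_betw_Pow)
  moreover have "card (h ` S) = card S" if "S \<subseteq> V" for S
    using that assms by (meson bij_betw_def card_image inj_on_subset)
  ultimately have "bij_betw ((`) h) {S\<in>Pow V. card S = i} {S\<in>Pow V'. card S = i}"
    by (intro bij_betw_Collect) auto
  then show ?thesis by simp
qed

text \<open>A bijection of the variables permutes the subsets that index each \<open>esym\<close>,
  so corresponding exponents have equal coefficients. For \<open>V = V'\<close> this is the
  invariance of \<open>emon V b\<close> under permutations.\<close>

lemma emon_related:
  assumes h: "bij_betw h V V'" and fin: "finite V" and rel: "related h V V' \<kappa> \<kappa>'"
  shows "lookup (emon V b) \<kappa> = lookup (emon V' b) \<kappa>'"
proof -
  define Q where "Q = (\<lambda>f f' :: Kpoly. \<forall>\<kappa> \<kappa>'. related h V V' \<kappa> \<kappa>' \<longrightarrow> lookup f \<kappa> = lookup f' \<kappa>')"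
  have fin': "finite V'" using h fin bij_betw_finite by blast
  have "Q (emon V b) (emon V' b)"
  proof (rule emon_rel_induct[OF refl])
    show "Q 1 1"
    proof -
      have "\<kappa> = 0 \<longleftrightarrow> \<kappa>' = 0" if "related h V V' \<kappa> \<kappa>'" for \<kappa> \<kappa>' 
      proof -
        have zero: "x = 0 \<longleftrightarrow> (\<forall>v\<in>U. lookup x v = 0)" if "keys x \<subseteq> U" for x :: "'z \<Rightarrow>\<^sub>0 nat" and U
          using that by (metis in_keys_iff lookup_zero poly_mapping_eqI subsetD)
        show ?thesis
          using that bij_betw_imp_surj_on[OF h] by (auto simp: related_def zero[of \<kappa> V] zero[of \<kappa>' V'])
      qed
      then show ?thesis by (auto simp: Q_def lookup_one when_def)
    qed
  next
    fix i f f' assume Q: "Q f f'"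
    show "Q (esym V (Suc i) * f) (esym V' (Suc i) * f')"
      unfolding Q_def
    proof (intro allI impI)
      fix \<kappa> \<kappa>' assume rel: "related h V V' \<kappa> \<kappa>'"
      have "lookup (esym V' (Suc i) * f') \<kappa>' = (\<Sum>S | S \<subseteq> V \<and> card S = Suc i. 
          if h ` S \<subseteq> keys \<kappa>' then lookup f' (\<kappa>' - ind (h ` S)) else 0)"
        unfolding lookup_esym_mult[OF fin']
        by (rule sum.reindex_bij_betw[OF bij_betw_card_subsets[OF h], symmetric])
      also have "\<dots> = lookup (esym V (Suc i) * f) \<kappa>"
        unfolding lookup_esym_mult[OF fin]
      proof (rule sum.cong[OF refl])
        fix S assume "S \<in> {S. S \<subseteq> V \<and> card S = Suc i}"
        then have S: "S \<subseteq> V" by auto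
        show "(if h ` S \<subseteq> keys \<kappa>' then lookup f' (\<kappa>' - ind (h ` S)) else 0)
          = (if S \<subseteq> keys \<kappa> then lookup f (\<kappa> - ind S) else 0)"
          using related_subset_keys[OF rel S] related_minus_ind[OF rel h S fin] Q by (simp add: Q_def)
      qed
      finally show "lookup (esym V (Suc i) * f) \<kappa> = lookup (esym V' (Suc i) * f') \<kappa>'" ..
    qed
  qed
  then show ?thesis using rel by (auto simp: Q_def)
qed

text \<open>Families with the same multiset of values differ by a reindexing. An arbitrary bijection
  \<open>h0\<close> brings both families onto \<open>V\<close>, and a permutation of
  \<open>V\<close> then corrects it.\<close>

lemma image_mset_eq_imp_bij_betw:
  assumes "finite V" "finite V'" "image_mset f (mset_set V) = image_mset g (mset_set V')"
  shows "\<exists>h. bij_betw h V V' \<and> (\<forall>v\<in>V. f v = g (h v))"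
proof -
  have "card V = card V'"
    using arg_cong[OF assms(3), of size] by simp
  then obtain h0 where h0: "bij_betw h0 V V'"
    using assms finite_same_card_bij by blast
  have "image_mset f (mset_set V) = image_mset (g \<circ> h0) (mset_set V)"
    using assms(3) h0
    by (simp add: multiset.map_comp[symmetric] image_mset_mset_set bij_betw_def)
  then obtain p where p: "p permutes V" "\<forall>x\<in>V. f x = (g \<circ> h0) (p x)"
    using image_mset_eq_implies_permutes[OF assms(1)] by metis
  then have "bij_betw (h0 \<circ> p) V V'"
    using h0 permutes_imp_bij bij_betw_trans by blast
  with p show ?thesis by (intro exI[of _ "h0 \<circ> p"]) auto
qed

subsection \<open>Monomials and leading exponents\<close>

text \<open>Monomials of \<open>A\<close> as multisets of variable indices; multiplication becomes
  union of multisets.\<close>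

definition mon :: "nat multiset \<Rightarrow> (nat \<Rightarrow>\<^sub>0 nat)" where
  "mon M = (\<Sum>a\<in>#M. single a 1)"

lemma lookup_mon: "lookup (mon M) i = count M i"
  by (induction M) (auto simp: mon_def lookup_add lookup_single when_def)

lemma mon_union: "mon (M + N) = mon M + mon N"
  by (simp add: mon_def)

lemma bij_mon: "bij mon"
proof (rule bijI)
  show "inj mon"
    by (rule injI, rule multiset_eqI) (metis lookup_mon)
  have "\<exists>M. m = mon M" for m
  proof -
    have "finite {x. 0 < lookup m x}"
      using finite_lookup[of m] by simp
    then have "count (Abs_multiset (lookup m)) = lookup m"
      by (rule Abs_multiset_inverse[OF CollectI])
    then show ?thesis
      by (intro exI[of _ "Abs_multiset (lookup m)"] poly_mapping_eqI) (simp add: lookup_mon)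
  qed
  then show "surj mon" by (simp add: surj_def)
qed

text \<open>Variable \<open>i\<close> of \<open>A\<close> is \<open>x_(i+1)\<close>, which explains the shift of exponents by one; a zero
  exponent is a junk case, excluded below by \<open>keys \<kappa> = V\<close>.\<close>

definition xmon :: "'v set \<Rightarrow> ('v \<Rightarrow>\<^sub>0 nat) \<Rightarrow> (nat \<Rightarrow>\<^sub>0 nat)" where
  "xmon V \<kappa> = mon (image_mset (\<lambda>v. lookup \<kappa> v - 1) (mset_set V))"

lemma lookup_xmon:
  assumes "finite V"
  shows "lookup (xmon V \<kappa>) i = card {v\<in>V. lookup \<kappa> v - 1 = i}"
proof -
  have "(\<lambda>v. lookup \<kappa> v - 1) -` {i} \<inter> V = {v\<in>V. lookup \<kappa> v - 1 = i}"
    by auto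
  then show ?thesis using assms
    by (simp add: xmon_def lookup_mon count_image_mset)
qed

lemma xmon_union:
  assumes "finite V" "finite V'" "V \<inter> V' = {}" "keys \<kappa> \<subseteq> V" "keys \<kappa>' \<subseteq> V'"
  shows "xmon (V \<union> V') (\<kappa> + \<kappa>') = xmon V \<kappa> + xmon V' \<kappa>'"
proof -
  have "lookup \<kappa>' v = 0" if "v \<in> V" for v
    using assms(3,5) that by (meson disjoint_iff in_keys_iff subsetD)
  then have "image_mset (\<lambda>v. lookup (\<kappa> + \<kappa>') v - 1) (mset_set V) = image_mset (\<lambda>v. lookup \<kappa> v - 1) (mset_set V)"
    using assms(1) by (intro image_mset_cong) (simp add: lookup_add)
  moreover have "lookup \<kappa> v = 0" if "v \<in> V'" for v
    using assms(3,4) that by (meson disjoint_iff in_keys_iff subsetD)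
  then have "image_mset (\<lambda>v. lookup (\<kappa> + \<kappa>') v - 1) (mset_set V') = image_mset (\<lambda>v. lookup \<kappa>' v - 1) (mset_set V')"
    using assms(2) by (intro image_mset_cong) (simp add: lookup_add)
  ultimately show ?thesis
    using assms by (simp add: xmon_def mset_set_Union mon_union)
qed

section \<open>Weights and leading terms\<close>

definition wt :: "(nat + nat \<Rightarrow>\<^sub>0 nat) \<Rightarrow> nat" where
  "wt \<kappa> = lin_ext (case_sum Suc Suc) \<kappa>"

lemma wt_add: "wt (\<kappa> + \<kappa>') = wt \<kappa> + wt \<kappa>'"
  by (simp add: wt_def lin_ext_add)

lemma wt_sum: "wt (sum f S) = (\<Sum>s\<in>S. wt (f s))"
  by (simp add: wt_def lin_ext_sum)

text \<open>The leading term is the unique lightest one and has coefficient 1. Other terms may tie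
  in weight with each other, so no total order on exponents has to be chosen.\<close>

definition is_lead :: "Kpoly \<Rightarrow> (nat + nat \<Rightarrow>\<^sub>0 nat) \<Rightarrow> bool" where
  "is_lead f \<mu> \<longleftrightarrow> lookup f \<mu> = 1 \<and> (\<forall>\<kappa>\<in>keys f. wt \<mu> \<le> wt \<kappa> \<and> (wt \<kappa> = wt \<mu> \<longrightarrow> \<kappa> = \<mu>))"

lemma is_lead_one: "is_lead 1 0"
  by (simp add: is_lead_def)

text \<open>Weights add, so a term of minimal weight in the product can only come from the two
  leading terms. Its coefficient is therefore a single product \<open>1 * 1\<close>.\<close>

lemma is_lead_mult:
  assumes "is_lead f \<mu>" "is_lead g \<nu>"
  shows "is_lead (f * g) (\<mu> + \<nu>)"
proof -
  have eq: "\<kappa> = \<mu> \<and> \<kappa>' = \<nu>" if "\<kappa> \<in> keys f" "\<kappa>' \<in> keys g" "wt \<kappa> + wt \<kappa>' = wt \<mu> + wt \<nu>" for \<kappa> \<kappa>'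
  proof -
    have "wt \<mu> \<le> wt \<kappa>" "wt \<nu> \<le> wt \<kappa>'"
      using assms that by (auto simp: is_lead_def)
    then have "wt \<kappa> = wt \<mu>" "wt \<kappa>' = wt \<nu>"
      using that(3) by linarith+
    then show ?thesis using assms that by (auto simp: is_lead_def)
  qed
  have mem: "\<mu> \<in> keys f" "\<nu> \<in> keys g"
    using assms by (auto simp: is_lead_def in_keys_iff)
  have "lookup (f * g) (\<mu> + \<nu>) =
      (\<Sum>m\<in>keys f. \<Sum>m'\<in>keys g. if m = \<mu> \<and> m' = \<nu> then lookup f m * lookup g m' else 0)"
    unfolding lookup_mult_expand
  proof (intro sum.cong refl)
    fix m m' assume "m \<in> keys f" "m' \<in> keys g"
    then have "m + m' = \<mu> + \<nu> \<longleftrightarrow> m = \<mu> \<and> m' = \<nu>"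
      by (metis eq wt_add)
    then show "(if m + m' = \<mu> + \<nu> then lookup f m * lookup g m' else 0) =
        (if m = \<mu> \<and> m' = \<nu> then lookup f m * lookup g m' else 0)" by simp
  qed
  also have "\<dots> = (\<Sum>m\<in>keys f. if m = \<mu> then lookup f m * lookup g \<nu> else 0)"
    using mem by (intro sum.cong refl) auto
  also have "\<dots> = lookup f \<mu> * lookup g \<nu>"
    using mem by simp
  finally have "lookup (f * g) (\<mu> + \<nu>) = 1"
    using assms by (simp add: is_lead_def)
  moreover have "wt (\<mu> + \<nu>) \<le> wt \<kappa> \<and> (wt \<kappa> = wt (\<mu> + \<nu>) \<longrightarrow> \<kappa> = \<mu> + \<nu>)" if \<kappa>: "\<kappa> \<in> keys (f * g)" for \<kappa>
  proof -
    obtain a b where ab: "\<kappa> = a + b" "a \<in> keys f" "b \<in> keys g"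
      using subsetD[OF keys_mult \<kappa>] by auto
    then have "wt \<mu> \<le> wt a" "wt \<nu> \<le> wt b"
      using assms by (auto simp: is_lead_def)
    then show ?thesis using ab eq by (auto simp: wt_add)
  qed
  ultimately show ?thesis by (simp add: is_lead_def)
qed

lemma is_lead_prod:
  assumes "\<And>i. i \<in> I \<Longrightarrow> is_lead (f i) (\<mu> i)"
  shows "is_lead (prod f I) (sum \<mu> I)"
  using assms by (induction I rule: infinite_finite_induct) (auto intro: is_lead_one is_lead_mult)

lemma is_lead_power:
  assumes "is_lead f \<mu>"
  shows "is_lead (f ^ k) (\<Sum>_<k. \<mu>)"
  using is_lead_prod[of "{..<k}" "\<lambda>_. f" "\<lambda>_. \<mu>"] assms by simp

text \<open>An exchange argument: \<open>T\<close> has as many elements outside the segment as the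
  segment has outside \<open>T\<close>. The former contribute at least \<open>i + 1\<close> each and
  the latter at most \<open>i\<close>, so every exchanged element costs at least one.\<close>

lemma sum_Suc_initial_segment_minimal:
  assumes "finite T" "card T = i"
  shows "sum Suc {..<i} \<le> sum Suc T \<and> (sum Suc T = sum Suc {..<i} \<longrightarrow> T = {..<i})"
proof -
  have d: "card (T - {..<i}) = card ({..<i} - T)"
    using assms card_Diff_subset_Int[of T "{..<i}"] card_Diff_subset_Int[of "{..<i}" T]
    by (simp add: Int_commute)
  have "sum Suc T = sum Suc (T \<inter> {..<i}) + sum Suc (T - {..<i})"
    using assms by (simp add: sum.Int_Diff)
  moreover have "sum Suc {..<i} = sum Suc (T \<inter> {..<i}) + sum Suc ({..<i} - T)"
    by (subst Int_commute) (simp add: sum.Int_Diff)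
  moreover have "card (T - {..<i}) * Suc i \<le> sum Suc (T - {..<i})"
    using sum_bounded_below[of "T - {..<i}" "Suc i" Suc] by auto
  moreover have "sum Suc ({..<i} - T) \<le> card ({..<i} - T) * i"
    using sum_bounded_above[of "{..<i} - T" Suc i] by auto
  ultimately have le: "sum Suc {..<i} + card (T - {..<i}) \<le> sum Suc T"
    using d by simp
  have "T = {..<i}" if "sum Suc T = sum Suc {..<i}"
  proof -
    have "card (T - {..<i}) = 0" using le that by simp
    then have "T \<subseteq> {..<i}" using assms by auto
    then show ?thesis using assms card_subset_eq[of "{..<i}" T] by simp
  qed
  with le show ?thesis by simp
qed

lemma ind_inject:
  assumes "finite S" "finite T" "ind S = ind T"
  shows "S = T"
proof -
  have "v \<in> S \<longleftrightarrow> v \<in> T" for v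
    using arg_cong[OF assms(3), of "\<lambda>x. lookup x v"] assms(1,2) by (auto simp: lookup_ind split: if_splits)
  then show ?thesis by blast
qed

lemma keys_ind: "finite S \<Longrightarrow> keys (ind S) = S"
  by (auto simp: in_keys_iff lookup_ind split: if_splits)

lemma lookup_esym_ind:
  assumes "finite V" "S \<subseteq> V" "card S = i"
  shows "lookup (esym V i) (ind S) = 1"
proof -
  have "(ind T = ind S) = (T = S)" if "T \<subseteq> V" for T
    using ind_inject[of T S] that assms by (auto intro: finite_subset)
  then have "lookup (esym V i) (ind S) = (\<Sum>T | T \<subseteq> V \<and> card T = i. if T = S then 1 else 0)"
    unfolding esym_eq lookup_sum lookup_single when_def by (intro sum.cong) auto
  then show ?thesis using assms by simp
qed

lemma keys_esym:
  assumes "\<kappa> \<in> keys (esym V i)"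
  obtains S where "S \<subseteq> V" "card S = i" "\<kappa> = ind S"
proof -
  have "keys (esym V i) \<subseteq> (\<Union>S\<in>{S. S \<subseteq> V \<and> card S = i}. keys (single (ind S) (1::int)))"
    unfolding esym_eq by (rule keys_sum)
  then show ?thesis using assms that by auto
qed

lemma wt_ind_Inl: "finite T \<Longrightarrow> wt (ind (Inl ` T)) = sum Suc T"
  by (simp add: ind_def wt_sum sum.reindex) (simp add: wt_def)

lemma is_lead_esym:
  assumes "i \<le> n"
  shows "is_lead (esym (kvars n) i) (ind (Inl ` {..<i}))"
proof -
  have "lookup (esym (kvars n) i) (ind (Inl ` {..<i})) = 1"
    using assms by (intro lookup_esym_ind) (auto simp: kvars_def card_image)
  moreover have "wt (ind (Inl ` {..<i})) \<le> wt \<kappa> \<and> (wt \<kappa> = wt (ind (Inl ` {..<i})) \<longrightarrow> \<kappa> = ind (Inl ` {..<i}))"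
    if \<kappa>: "\<kappa> \<in> keys (esym (kvars n) i)" for \<kappa>
  proof -
    obtain S where S: "S \<subseteq> kvars n" "card S = i" "\<kappa> = ind S"
      by (rule keys_esym[OF \<kappa>])
    then obtain T where T: "S = Inl ` T" "T \<subseteq> {..<n}"
      unfolding kvars_def by (meson subset_imageE)
    have "finite T" "card T = i"
      using T S finite_subset[OF T(2)] by (auto simp: card_image)
    then have "wt (ind (Inl ` {..<i})) \<le> wt \<kappa>" "wt \<kappa> = wt (ind (Inl ` {..<i})) \<Longrightarrow> T = {..<i}"
      using sum_Suc_initial_segment_minimal[of T i] unfolding S(3) T(1) by (simp_all only: wt_ind_Inl finite_lessThan)
    then show ?thesis unfolding S(3) T(1) by blast
  qed
  ultimately show ?thesis by (simp add: is_lead_def)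
qed

text \<open>The partition whose conjugate has \<open>b ! i\<close> parts equal to
  \<open>i + 1\<close>.\<close>

definition parts :: "nat list \<Rightarrow> nat \<Rightarrow> nat" where
  "parts b j = (\<Sum>i=j..<length b. b ! i)"

text \<open>The leading exponent of \<open>e_(i+1)\<close> is that of
  \<open>k_1 ... k_(i+1)\<close>, so the leading exponent of \<open>e^\<beta>\<close> is the partition \<open>parts \<beta>\<close>.\<close>

definition lead :: "nat list \<Rightarrow> (nat + nat \<Rightarrow>\<^sub>0 nat)" where
  "lead b = (\<Sum>i<length b. \<Sum>_<b ! i. ind (Inl ` {..<Suc i}))"

lemma lookup_lead_Inr [simp]: "lookup (lead b) (Inr j) = 0"
  by (simp add: lead_def lookup_sum lookup_ind image_iff)

lemma lookup_lead_Inl [simp]: "lookup (lead b) (Inl j) = parts b j"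
proof -
  have "lookup (lead b) (Inl j) = (\<Sum>i<length b. if j \<le> i then b ! i else 0)"
    by (simp add: lead_def lookup_sum lookup_ind image_iff less_Suc_eq_le if_distrib[of "(*) _"] cong: if_cong)
  also have "\<dots> = (\<Sum>i\<in>{i\<in>{..<length b}. j \<le> i}. b ! i)"
    by (rule sum.inter_filter[symmetric]) simp
  also have "{i\<in>{..<length b}. j \<le> i} = {j..<length b}" by auto
  finally show ?thesis by (simp add: parts_def)
qed

lemma is_lead_emon: "is_lead (emon (kvars (length b)) b) (lead b)"
  unfolding emon_def lead_def
  by (intro is_lead_prod is_lead_power) (auto intro: is_lead_esym[of "Suc _", simplified])

definition Bunion :: "nat list set" where
  "Bunion = (\<Union>l. Bset l)"

lemma Bset_iff: "b \<in> Bset l \<longleftrightarrow> length b = l \<and> (b = [] \<or> b ! (length b - 1) \<ge> 1)"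
  by (auto simp: Bset_def)

lemma Bunion_iff: "b \<in> Bunion \<longleftrightarrow> b = [] \<or> b ! (length b - 1) \<ge> 1"
  by (auto simp: Bunion_def Bset_iff)

lemma parts_Suc: "j < length b \<Longrightarrow> parts b j = b ! j + parts b (Suc j)"
  by (simp add: parts_def sum.atLeast_Suc_lessThan)

lemma parts_ge_length: "j \<ge> length b \<Longrightarrow> parts b j = 0"
  by (simp add: parts_def)

lemma parts_antimono: "i \<le> j \<Longrightarrow> parts b j \<le> parts b i"
  unfolding parts_def by (rule sum_mono2) auto

text \<open>The positive last entry of a tuple in \<open>Bunion\<close> is a summand of every part.
  Positivity ensures that the shift by one in \<open>xmon\<close> loses no information.\<close>

lemma parts_pos:
  assumes "b \<in> Bunion" "j < length b"
  shows "parts b j \<ge> 1"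
proof -
  have "b ! (length b - 1) \<le> parts b j"
    unfolding parts_def using assms(2) by (intro member_le_sum) auto
  then show ?thesis using assms by (auto simp: Bunion_iff)
qed

lemma keys_lead: "b \<in> Bunion \<Longrightarrow> keys (lead b) = kvars (length b)"
proof -
  assume b: "b \<in> Bunion"
  have "v \<in> keys (lead b) \<longleftrightarrow> v \<in> kvars (length b)" for v
  proof (cases v)
    case (Inl j)
    then show ?thesis using parts_pos[OF b, of j] parts_ge_length[of b j]
      by (cases "j < length b") (auto simp: in_keys_iff kvars_def)
  qed (auto simp: in_keys_iff kvars_def)
  then show ?thesis by blast
qed

definition lead_mon :: "nat list \<Rightarrow> (nat \<Rightarrow>\<^sub>0 nat)" where
  "lead_mon b = xmon (kvars (length b)) (lead b)"

lemma lead_mon_alt: "lead_mon b = mon (mset (map (\<lambda>j. parts b j - 1) [0..<length b]))"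
proof -
  have "mset_set (kvars (length b)) = image_mset Inl (mset_set {..<length b})"
    by (simp add: kvars_def image_mset_mset_set)
  then show ?thesis
    by (simp add: lead_mon_def xmon_def multiset.map_comp comp_def lessThan_atLeast0)
qed

text \<open>The parts decrease, so their multiset determines their order. Positivity undoes the
  shift by one, and differences of consecutive parts return the entries of the tuple.\<close>

lemma inj_lead_mon: "inj_on lead_mon Bunion"
proof (rule inj_onI)
  fix b c assume b: "b \<in> Bunion" and c: "c \<in> Bunion" and eq: "lead_mon b = lead_mon c"
  let ?f = "\<lambda>b. map (\<lambda>j. parts b j - 1) [0..<length b]"
  have sorted: "sorted (rev (?f b))" for b
    by (auto simp: sorted_rev_iff_nth_mono intro!: diff_le_mono parts_antimono)
  have "mset (rev (?f b)) = mset (rev (?f c))"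
    using eq bij_mon by (auto simp: lead_mon_alt bij_def inj_eq simp del: mset_map)
  then have f_eq: "?f b = ?f c"
    using properties_for_sort[OF _ sorted[of b], of "rev (?f c)"] sorted_sort_id[OF sorted[of c]] by simp
  then have len: "length b = length c"
    by (metis length_map length_upt diff_zero)
  have parts: "parts b j = parts c j" for j
  proof (cases "j < length b")
    case True
    then have "parts b j - 1 = parts c j - 1"
      using f_eq len nth_map_upt[of j "length b" 0 "\<lambda>j. parts b j - 1"]
        nth_map_upt[of j "length c" 0 "\<lambda>j. parts c j - 1"] by simp
    then show ?thesis
      using parts_pos[OF b, of j] parts_pos[OF c, of j] True len by simp
  qed (simp add: parts_ge_length len)
  show "b = c"
    using parts_Suc[of _ b] parts_Suc[of _ c] parts len by (intro nth_equalityI) auto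
qed

lemma surj_lead_mon: "lead_mon ` Bunion = UNIV"
proof -
  have "m \<in> lead_mon ` Bunion" for m
  proof -
    obtain M where M: "m = mon M"
      using bij_mon by (metis bij_pointE)
    \<comment> \<open>The variable indices of \<open>m\<close>, with multiplicity, in decreasing
      order: the intended parts minus one.\<close>
    define xs where "xs = rev (sorted_list_of_multiset M)"
    define n where "n = length xs"
    have mset_xs: "mset xs = M" by (simp add: xs_def)
    have dec: "xs ! Suc j \<le> xs ! j" if "Suc j < n" for j
      using sorted_sorted_list_of_multiset[of M] that
      unfolding xs_def[symmetric] n_def
      using sorted_rev_nth_mono[of xs j "Suc j"] by (simp add: xs_def)
    \<comment> \<open>Entries are the consecutive differences of the parts
      \<open>Suc (xs ! j)\<close>. The last part has no successor and is taken whole, whence the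
      \<open>Suc\<close>, which also places \<open>b\<close> in \<open>Bunion\<close>.\<close>
    define b where "b = map (\<lambda>j. if Suc j < n then xs ! j - xs ! Suc j else Suc (xs ! j)) [0..<n]"
    have len: "length b = n" by (simp add: b_def)
    have "parts b j = Suc (xs ! j)" if "j < n" for j
      using that
    proof (induction "n - j" arbitrary: j)
      case (Suc k)
      show ?case
      proof (cases "Suc j < n")
        case True
        then have "parts b (Suc j) = Suc (xs ! Suc j)"
          using Suc by simp
        then show ?thesis using parts_Suc[of j b] Suc True dec[of j] len by (simp add: b_def)
      next
        case False
        then show ?thesis using parts_Suc[of j b] Suc len by (simp add: b_def parts_ge_length)
      qed
    qed simp
    then have "map (\<lambda>j. parts b j - 1) [0..<length b] = xs"
      by (intro nth_equalityI) (auto simp: len n_def)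
    then have "lead_mon b = m"
      using M mset_xs by (simp add: lead_mon_alt del: mset_map)
    moreover have "b \<in> Bunion"
      by (cases n) (auto simp: Bunion_iff len b_def nth_append)
    ultimately show ?thesis by blast
  qed
  then show ?thesis by auto
qed

text \<open>The tuple labelling a monomial. Its length is the number of factors of the monomial
  counted with multiplicity, so \<open>length (idx m)\<close> serves below as the degree of
  \<open>m\<close>.\<close>

definition idx :: "(nat \<Rightarrow>\<^sub>0 nat) \<Rightarrow> nat list" where
  "idx = inv_into Bunion lead_mon"

lemma idx_in [simp]: "idx m \<in> Bunion" and lead_mon_idx [simp]: "lead_mon (idx m) = m"
  using surj_lead_mon by (auto simp: idx_def inv_into_into f_inv_into_f)

lemma idx_lead_mon [simp]: "b \<in> Bunion \<Longrightarrow> idx (lead_mon b) = b"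
  by (simp add: idx_def inj_lead_mon)

text \<open>The leading exponent of \<open>idx m\<close> is a canonical choice among the exponents
  that represent \<open>m\<close>; by symmetry the coefficient does not depend on this choice, as
  \<open>pair_xmon\<close> shows.\<close>

definition pair :: "(nat \<Rightarrow>\<^sub>0 nat) \<Rightarrow> nat list \<Rightarrow> int" where
  "pair m b = (if length b = length (idx m) then lookup (emon (kvars (length b)) b) (lead (idx m)) else 0)"

lemma card_kvars [simp]: "card (kvars n) = n" and card_kpvars [simp]: "card (kpvars n) = n"
  by (simp_all add: kvars_def kpvars_def card_image)

lemma finite_kvars [simp]: "finite (kvars n)" and finite_kpvars [simp]: "finite (kpvars n)"
  by (simp_all add: kvars_def kpvars_def)

lemma length_idx_xmon:
  assumes "finite V"
  shows "length (idx (xmon V \<kappa>)) = card V"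
proof -
  let ?b = "idx (xmon V \<kappa>)"
  have "xmon (kvars (length ?b)) (lead ?b) = xmon V \<kappa>"
    using lead_mon_idx[of "xmon V \<kappa>"] by (simp only: lead_mon_def)
  then have "image_mset (\<lambda>v. lookup (lead ?b) v - 1) (mset_set (kvars (length ?b)))
      = image_mset (\<lambda>v. lookup \<kappa> v - 1) (mset_set V)"
    using bij_mon by (simp only: xmon_def bij_def inj_eq)
  from arg_cong[OF this, of size] show ?thesis by simp
qed

text \<open>Any exponent with full support that represents the same monomial is a renaming of the
  canonical one, and \<open>emon\<close> is symmetric. Full support makes all exponents positive, so
  equality after the shift by one implies equality.\<close>

lemma pair_xmon:
  assumes fin: "finite V" and keys: "keys \<kappa> = V"
  shows "pair (xmon V \<kappa>) b = (if length b = card V then lookup (emon V b) \<kappa> else 0)"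
proof (cases "length b = card V")
  case True
  let ?c = "idx (xmon V \<kappa>)"
  have len: "length ?c = card V" using fin by (rule length_idx_xmon)
  have "xmon (kvars (card V)) (lead ?c) = xmon V \<kappa>"
    using lead_mon_idx[of "xmon V \<kappa>"] by (simp only: lead_mon_def len)
  then have "image_mset (\<lambda>v. lookup \<kappa> v - 1) (mset_set V)
      = image_mset (\<lambda>v. lookup (lead ?c) v - 1) (mset_set (kvars (card V)))"
    using bij_mon by (simp only: xmon_def bij_def inj_eq)
  from image_mset_eq_imp_bij_betw[OF fin _ this] obtain h where h: "bij_betw h V (kvars (card V))"
    and h_eq: "\<forall>v\<in>V. lookup \<kappa> v - 1 = lookup (lead ?c) (h v) - 1" by auto
  have keys': "keys (lead ?c) = kvars (card V)" using len by (simp add: keys_lead)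
  have "related h V (kvars (card V)) \<kappa> (lead ?c)"
    unfolding related_def
  proof (intro conjI ballI)
    fix v assume v: "v \<in> V"
    then have "lookup \<kappa> v \<noteq> 0" using keys by (auto simp: in_keys_iff)
    moreover have "lookup (lead ?c) (h v) \<noteq> 0"
      using v h keys' by (metis bij_betw_apply in_keys_iff)
    ultimately show "lookup \<kappa> v = lookup (lead ?c) (h v)"
      using h_eq v by (metis Suc_pred' neq0_conv diff_Suc_1 One_nat_def)
  qed (use keys keys' in auto)
  from emon_related[OF h fin this] show ?thesis
    using True len by (simp add: pair_def)
qed (use fin in \<open>simp add: pair_def length_idx_xmon\<close>)

subsection \<open>The pairing and the kernel of the derivation\<close>

lemma pair_length: "pair m b \<noteq> 0 \<Longrightarrow> length b = length (idx m)"
  by (simp add: pair_def split: if_splits)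

lemma pair_lead_mon: "b \<in> Bunion \<Longrightarrow> pair (lead_mon b) b = 1"
  using is_lead_emon[of b] by (simp add: pair_def is_lead_def)

text \<open>A nonzero pairing says that the leading exponent of \<open>idx m\<close> occurs in
  \<open>emon\<close> of \<open>b\<close>, hence is no lighter than the leading exponent of
  \<open>b\<close>. In the case of equality, injectivity of \<open>lead_mon\<close> identifies the
  tuples.\<close>

lemma pair_triangular:
  assumes "pair m b \<noteq> 0" "b \<in> Bunion"
  shows "wt (lead b) \<le> wt (lead (idx m)) \<and> (wt (lead (idx m)) = wt (lead b) \<longrightarrow> idx m = b)"
proof -
  have len: "length b = length (idx m)" using assms(1) by (rule pair_length)
  have "lead (idx m) \<in> keys (emon (kvars (length b)) b)"
    using assms(1) len by (simp add: pair_def in_keys_iff)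
  then have "wt (lead b) \<le> wt (lead (idx m))"
    and eq: "wt (lead (idx m)) = wt (lead b) \<longrightarrow> lead (idx m) = lead b"
    using is_lead_emon[of b] by (auto simp: is_lead_def)
  moreover have "idx m = b" if "lead (idx m) = lead b"
  proof -
    have "lead_mon (idx m) = lead_mon b" by (simp only: lead_mon_def len that)
    then show ?thesis using assms(2) idx_lead_mon[of b] by simp
  qed
  ultimately show ?thesis by blast
qed

lemma nth_le_wt_lead:
  assumes "i < length b"
  shows "b ! i \<le> wt (lead b)"
proof -
  \<comment> \<open>The factor is the weight of the leading exponent of the elementary symmetric
    polynomial of degree \<open>i + 1\<close>, in particular positive.\<close>
  have "b ! i \<le> b ! i * sum Suc {..<Suc i}" by simp
  also have "\<dots> \<le> (\<Sum>i<length b. b ! i * sum Suc {..<Suc i})"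
    using assms member_le_sum[of i "{..<length b}" "\<lambda>i. b ! i * sum Suc {..<Suc i}"] by simp
  also have "\<dots> = wt (lead b)"
    by (simp add: lead_def wt_sum wt_ind_Inl)
  finally show ?thesis .
qed

text \<open>Triangularity bounds the leading weight, which bounds every entry, and the length is
  fixed by \<open>m\<close>.\<close>

lemma finite_pair_support: "finite {b\<in>Bunion. pair m b \<noteq> 0}"
proof (rule finite_subset)
  show "{b\<in>Bunion. pair m b \<noteq> 0} \<subseteq>
      {b. set b \<subseteq> {..wt (lead (idx m))} \<and> length b = length (idx m)}"
  proof clarify
    fix b assume b: "b \<in> Bunion" "pair m b \<noteq> 0"
    have "wt (lead b) \<le> wt (lead (idx m))" using pair_triangular[OF b(2,1)] by simp
    then have "set b \<subseteq> {..wt (lead (idx m))}"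
      using nth_le_wt_lead[of _ b] by (force simp: in_set_conv_nth intro: order_trans)
    then show "set b \<subseteq> {..wt (lead (idx m))} \<and> length b = length (idx m)"
      using pair_length[OF b(2)] by blast
  qed
qed (simp add: finite_lists_length_eq)

section \<open>The linear pairing and its nondegeneracy\<close>

definition pr :: "Apoly \<Rightarrow> nat list \<Rightarrow> complex" where
  "pr p b = lin_ext (\<lambda>m. of_int (pair m b)) p"

lemma pr_add: "pr (p + q) b = pr p b + pr q b"
  by (simp add: pr_def lin_ext_add)

lemma pr_zero [simp]: "pr 0 b = 0"
  by (simp add: pr_def)

lemma pr_single [simp]: "pr (single m c) b = c * of_int (pair m b)"
  by (simp add: pr_def)

lemma pr_sum: "pr (sum f S) b = (\<Sum>s\<in>S. pr (f s) b)"
  by (simp add: pr_def lin_ext_sum)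

lemma lin_ext_scale: "lin_ext f (single 0 c * p) = c * lin_ext f p"
  for p :: "'a::comm_monoid_add \<Rightarrow>\<^sub>0 'b::comm_semiring_1"
proof (cases "c = 0")
  case False
  then show ?thesis by (simp add: lin_ext_mult) (simp add: lin_ext_def sum_distrib_left mult.assoc)
qed simp

lemma pr_scale: "pr (single 0 c * p) b = c * pr p b"
  by (simp add: pr_def lin_ext_scale)

lemma finite_pr_support: "finite {b\<in>Bunion. pr p b \<noteq> 0}"
proof (rule finite_subset)
  show "{b\<in>Bunion. pr p b \<noteq> 0} \<subseteq> (\<Union>m\<in>keys p. {b\<in>Bunion. pair m b \<noteq> 0})"
    by (force simp: pr_def lin_ext_def elim!: sum.not_neutral_contains_not_neutral)
qed (simp add: finite_pair_support)

text \<open>The cut-off to \<open>Bunion\<close> gives finite support, by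
  \<open>finite_pr_support\<close>, so that \<open>Abs_poly_mapping\<close> is meaningful.\<close>

definition phi :: "Apoly \<Rightarrow> (nat list \<Rightarrow>\<^sub>0 complex)" where
  "phi p = Abs_poly_mapping (\<lambda>b. if b \<in> Bunion then pr p b else 0)"

lemma lookup_phi: "lookup (phi p) b = (if b \<in> Bunion then pr p b else 0)"
proof -
  have "{b. (if b \<in> Bunion then pr p b else 0) \<noteq> 0} = {b\<in>Bunion. pr p b \<noteq> 0}" by auto
  then show ?thesis using finite_pr_support[of p] by (simp add: phi_def)
qed

lemma keys_phi: "keys (phi p) \<subseteq> Bunion"
  by (auto simp: in_keys_iff lookup_phi split: if_splits)

lemma phi_add: "phi (p + q) = phi p + phi q"
  by (rule poly_mapping_eqI) (simp add: lookup_add lookup_phi pr_add)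

text \<open>Among the monomials of \<open>p\<close>, take one of maximal leading weight. By
  triangularity no other monomial of \<open>p\<close> pairs with its tuple, so pairing with that
  tuple returns its coefficient.\<close>

lemma pr_separates:
  assumes "p \<noteq> 0"
  shows "\<exists>b\<in>Bunion. pr p b \<noteq> 0"
proof -
  have "keys p \<noteq> {}" using assms by (metis lookup_zero not_in_keys_iff_lookup_eq_zero poly_mapping_eqI empty_iff)
  then obtain m where m: "m \<in> keys p" and max: "\<And>m'. m' \<in> keys p \<Longrightarrow> wt (lead (idx m')) \<le> wt (lead (idx m))"
    using Max_in[of "(\<lambda>m. wt (lead (idx m))) ` keys p"] Max_ge[of "(\<lambda>m. wt (lead (idx m))) ` keys p"]
    by (smt (verit) finite_imageI finite_keys image_iff image_is_empty)
  have "pr p (idx m) = (\<Sum>m'\<in>keys p. if m' = m then lookup p m else 0)"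
    unfolding pr_def lin_ext_def
  proof (rule sum.cong[OF refl])
    fix m' assume m': "m' \<in> keys p"
    show "lookup p m' * of_int (pair m' (idx m)) = (if m' = m then lookup p m else 0)"
    proof (cases "m' = m")
      case True
      then show ?thesis using pair_lead_mon[of "idx m"] by simp
    next
      case False
      then have "idx m' \<noteq> idx m" by (metis lead_mon_idx)
      then have "pair m' (idx m) = 0"
        using pair_triangular[of m' "idx m"] max[OF m'] by fastforce
      with False show ?thesis by simp
    qed
  qed
  also have "\<dots> = lookup p m" using m by simp
  finally have "pr p (idx m) \<noteq> 0" using m by (simp add: in_keys_iff)
  then show ?thesis using idx_in by blast
qed

text \<open>Inverts the unitriangular pairing by induction on the weight: \<open>lead_mon b\<close>
  pairs to 1 with \<open>b\<close> and otherwise only with strictly lighter tuples, whose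
  contributions are cancelled by their own dual elements.\<close>

lemma exists_dual:
  assumes "b \<in> Bunion"
  shows "\<exists>p. \<forall>c\<in>Bunion. pr p c = (if c = b then 1 else 0)"
  using assms
proof (induction "wt (lead b)" arbitrary: b rule: less_induct)
  case less
  let ?C = "{c\<in>Bunion. pair (lead_mon b) c \<noteq> 0} - {b}"
  have C: "finite ?C" using finite_pair_support by simp
  have "\<exists>p. \<forall>c'\<in>Bunion. pr p c' = (if c' = c then 1 else 0)" if "c \<in> ?C" for c
  proof (rule less.hyps)
    show "wt (lead c) < wt (lead b)"
      using that pair_triangular[of "lead_mon b" c] less.prems by fastforce
  qed (use that in auto)
  then obtain P where P: "\<And>c c'. c \<in> ?C \<Longrightarrow> c' \<in> Bunion \<Longrightarrow> pr (P c) c' = (if c' = c then 1 else 0)"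
    by metis
  define p where "p = single (lead_mon b) 1 + (\<Sum>c\<in>?C. single 0 (- of_int (pair (lead_mon b) c)) * P c)"
  have "pr p c' = (if c' = b then 1 else 0)" if c': "c' \<in> Bunion" for c'
  proof -
    have "pr p c' = of_int (pair (lead_mon b) c') + (\<Sum>c\<in>?C. - of_int (pair (lead_mon b) c) * pr (P c) c')"
      by (simp add: p_def pr_add pr_sum pr_scale)
    also have "(\<Sum>c\<in>?C. - of_int (pair (lead_mon b) c) * pr (P c) c')
        = (\<Sum>c\<in>?C. if c = c' then - of_int (pair (lead_mon b) c') else 0)"
      using c' by (intro sum.cong) (auto simp: P)
    also have "\<dots> = (if c' \<in> ?C then - of_int (pair (lead_mon b) c') else 0)"
      using C by simp
    finally show ?thesis
      using c' pair_lead_mon[OF less.prems] by auto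
  qed
  then show ?case by blast
qed

definition dual :: "nat list \<Rightarrow> Apoly" where
  "dual b = (SOME p. \<forall>c\<in>Bunion. pr p c = (if c = b then 1 else 0))"

lemma pr_dual: "b \<in> Bunion \<Longrightarrow> c \<in> Bunion \<Longrightarrow> pr (dual b) c = (if c = b then 1 else 0)"
  using someI_ex[OF exists_dual[of b]] by (auto simp: dual_def)

lemma inj_phi: "inj phi"
proof (rule injI)
  fix p q assume eq: "phi p = phi q"
  have "pr (p - q) b = 0" if "b \<in> Bunion" for b
  proof -
    have "pr p b = pr q b"
      using arg_cong[OF eq, of "\<lambda>a. lookup a b"] that by (simp add: lookup_phi)
    moreover have "pr p b = pr (p - q) b + pr q b"
      by (simp flip: pr_add)
    ultimately show ?thesis by simp
  qed
  then have "p - q = 0" using pr_separates by blast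
  then show "p = q" by simp
qed

lemma range_phi: "range phi = {a. keys a \<subseteq> Bunion}"
proof (rule antisym)
  show "range phi \<subseteq> {a. keys a \<subseteq> Bunion}" using keys_phi by auto
  show "{a. keys a \<subseteq> Bunion} \<subseteq> range phi"
  proof clarify
    fix a :: "nat list \<Rightarrow>\<^sub>0 complex" assume a: "keys a \<subseteq> Bunion"
    define p where "p = (\<Sum>b\<in>keys a. single 0 (lookup a b) * dual b)"
    have "lookup (phi p) c = lookup a c" for c
    proof (cases "c \<in> Bunion")
      case True
      then have "pr p c = (\<Sum>b\<in>keys a. if b = c then lookup a c else 0)"
        using a unfolding p_def pr_sum pr_scale by (intro sum.cong) (auto simp: pr_dual)
      then show ?thesis using True by (auto simp: lookup_phi in_keys_iff)
    next
      case False
      then show ?thesis using a by (auto simp: lookup_phi in_keys_iff)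
    qed
    then have "phi p = a" by (rule poly_mapping_eqI)
    then show "a \<in> range phi" by blast
  qed
qed

text \<open>On exponents, \<open>raise\<close> is multiplication by \<open>e_1\<close>.\<close>

definition raise :: "nat list \<Rightarrow> nat list" where
  "raise b = b[0 := Suc (b ! 0)]"

lemma length_raise [simp]: "length (raise b) = length b"
  by (simp add: raise_def)

lemma emon_raise: "b \<noteq> [] \<Longrightarrow> emon V (raise b) = esym V 1 * emon V b"
  by (cases b) (simp_all add: raise_def emon_def prod.lessThan_Suc_shift mult.assoc del: prod.lessThan_Suc)

text \<open>Splits off the top factor. When \<open>length b = card V\<close>, that factor is the
  product of all variables, by \<open>esym_card\<close>.\<close>

lemma emon_last:
  assumes "b \<in> Bunion" "b \<noteq> []"
  shows "emon V b = esym V (length b) * emon V (b[length b - 1 := b ! (length b - 1) - 1])"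
proof -
  obtain k where k: "length b = Suc k" using assms by (cases b) auto
  then have "b ! k \<ge> 1" using assms by (auto simp: Bunion_iff)
  then obtain r where r: "b ! k = Suc r" by (cases "b ! k") auto
  have "(\<Prod>i<k. esym V (i + 1) ^ (b[k := r] ! i)) = (\<Prod>i<k. esym V (i + 1) ^ (b ! i))"
    by (intro prod.cong) auto
  then show ?thesis using k r by (simp add: emon_def mult.left_commute mult.commute)
qed

lemma esym_card: "finite V \<Longrightarrow> esym V (card V) = single (ind V) 1"
proof -
  assume V: "finite V"
  then have "{S. S \<subseteq> V \<and> card S = card V} = {V}" using card_subset_eq by auto
  then show ?thesis by (simp add: esym_eq)
qed

lemma lookup_emon_zero:
  assumes "finite V" "b \<in> Bunion" "length b = card V" "\<not> V \<subseteq> keys \<kappa>"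
  shows "lookup (emon V b) \<kappa> = 0"
proof -
  have "b \<noteq> []" using assms by auto
  then show ?thesis
    using assms by (simp add: emon_last esym_card lookup_ind_mult)
qed

lemma xmon_remove:
  assumes "finite V" "v \<in> V"
  shows "xmon V \<kappa> = single (lookup \<kappa> v - 1) 1 + xmon (V - {v}) \<kappa>"
  using assms by (simp add: xmon_def mset_set.remove mon_def)

text \<open>Lowering one exponent of \<open>\<kappa>\<close> replaces one factor of the monomial by
  the preceding variable, which is the effect of the derivation on that factor. The condition
  \<open>i \<noteq> 0\<close> keeps the lowered exponent positive.\<close>

lemma xmon_minus_ind:
  assumes "finite V" "v \<in> V" "lookup \<kappa> v - 1 = i" "i \<noteq> 0"
  shows "xmon V \<kappa> - single i 1 + single (i - 1) 1 = xmon V (\<kappa> - ind {v})"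
proof -
  have "xmon (V - {v}) (\<kappa> - ind {v}) = xmon (V - {v}) \<kappa>"
    using assms(1) unfolding xmon_def
    by (intro arg_cong[of _ _ mon] image_mset_cong) (simp add: lookup_minus lookup_ind)
  moreover have "lookup (\<kappa> - ind {v}) v - 1 = i - 1"
    using assms by (simp add: lookup_minus lookup_ind)
  ultimately show ?thesis
    using assms by (simp add: xmon_remove[of V v] add.commute)
qed

text \<open>Adjointness of the derivation and multiplication by the sum of the variables: both sides
  lower the exponent of one \<open>v\<close> in all possible ways.\<close>

lemma pr_dmon:
  assumes b: "b \<in> Bunion" "b \<noteq> []"
  shows "pr (dmon m) b = of_int (pair m (raise b))"
proof -
  define n where "n = length (idx m)"
  define V where "V = kvars n"
  define \<kappa> where "\<kappa> = lead (idx m)"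
  have fin: "finite V" and keys: "keys \<kappa> = V" and m: "xmon V \<kappa> = m" and cV: "card V = n"
    using lead_mon_idx[of m] by (simp_all add: V_def \<kappa>_def n_def keys_lead lead_mon_def del: lead_mon_idx)
  define L where "L v = (if length b = n then lookup (emon V b) (\<kappa> - ind {v}) else 0)" for v
  let ?g = "\<lambda>v. lookup \<kappa> v - 1"
  let ?S = "{v\<in>V. ?g v \<noteq> 0}"
  have pairL: "pair (m - single i 1 + single (i - 1) 1) b = L v" if "v \<in> V" "?g v = i" "i \<noteq> 0" for v i
  proof -
    have "keys (\<kappa> - ind {v}) = V"
      using keys that by (auto simp: in_keys_iff lookup_minus lookup_ind)
    then show ?thesis
      using xmon_minus_ind[OF fin that] pair_xmon[OF fin, of "\<kappa> - ind {v}" b] by (simp add: m L_def cV)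
  qed
  have g_keys: "?g v \<in> keys m" if "v \<in> V" for v
    using that fin m[symmetric] by (auto simp: in_keys_iff lookup_xmon card_eq_0_iff)
  have "pr (dmon m) b = (\<Sum>i\<in>keys m. pr (if i = 0 then 0 else
      single (m - single i 1 + single (i - 1) 1) (of_nat (lookup m i))) b)"
    by (simp add: dmon_def pr_sum)
  also have "\<dots> = (\<Sum>i\<in>keys m - {0}. of_int (of_nat (lookup m i) * pair (m - single i 1 + single (i - 1) 1) b))"
    by (intro sum.mono_neutral_cong_right) auto
  also have "\<dots> = of_int (\<Sum>i\<in>keys m - {0}. of_nat (lookup m i) * pair (m - single i 1 + single (i - 1) 1) b)"
    by simp
  \<comment> \<open>The multiplicity of variable \<open>i\<close> in \<open>m\<close> is the number
    of \<open>v\<close> mapped to \<open>i\<close>, so the sum over variables of \<open>A\<close>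
    becomes a sum over \<open>V\<close>.\<close>
  also have "(\<Sum>i\<in>keys m - {0}. of_nat (lookup m i) * pair (m - single i 1 + single (i - 1) 1) b)
      = (\<Sum>i\<in>keys m - {0}. sum L {v\<in>?S. ?g v = i})"
  proof (rule sum.cong[OF refl])
    fix i assume i: "i \<in> keys m - {0}"
    have S: "{v\<in>?S. ?g v = i} = {v\<in>V. ?g v = i}" using i by auto
    have "sum L {v\<in>V. ?g v = i} = (\<Sum>v\<in>{v\<in>V. ?g v = i}. pair (m - single i 1 + single (i - 1) 1) b)"
      using i by (intro sum.cong refl) (simp add: pairL[symmetric, of _ i])
    also have "\<dots> = of_nat (lookup m i) * pair (m - single i 1 + single (i - 1) 1) b"
      using lookup_xmon[OF fin, of \<kappa> i] by (simp add: m)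
    finally show "of_nat (lookup m i) * pair (m - single i 1 + single (i - 1) 1) b = sum L {v\<in>?S. ?g v = i}"
      by (simp only: S)
  qed
  also have "\<dots> = sum L ?S"
    using fin g_keys by (intro sum.group) auto
  \<comment> \<open>The added \<open>v\<close> carry exponent 1, hence the first variable of
    \<open>A\<close>, which the derivation kills. Lowering them removes \<open>v\<close> from the
    support, and \<open>emon V b\<close> has no such terms.\<close>
  also have "\<dots> = sum L V"
  proof (rule sum.mono_neutral_left)
    show "\<forall>v\<in>V - ?S. L v = 0"
    proof
      fix v assume v: "v \<in> V - ?S"
      then have "v \<notin> keys (\<kappa> - ind {v})"
        by (auto simp: in_keys_iff lookup_minus lookup_ind)
      then have "\<not> V \<subseteq> keys (\<kappa> - ind {v})" using v by auto
      then show "L v = 0" using lookup_emon_zero[OF fin b(1)] by (simp add: L_def cV)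
    qed
  qed (use fin in auto)
  also have "\<dots> = pair m (raise b)"
  proof (cases "length b = n")
    case True
    have sub: "{S. S \<subseteq> V \<and> card S = 1} = (\<lambda>v. {v}) ` V"
      by (auto simp: card_1_singleton_iff)
    have "pair m (raise b) = lookup (esym V 1 * emon V b) \<kappa>"
      using pair_xmon[OF fin keys, of "raise b"] True by (simp add: m cV emon_raise[OF b(2)])
    also have "\<dots> = (\<Sum>v\<in>V. lookup (emon V b) (\<kappa> - ind {v}))"
      unfolding lookup_esym_mult[OF fin] sub by (simp add: sum.reindex keys)
    finally show ?thesis using True by (simp add: L_def)
  next
    case False
    then show ?thesis by (simp add: L_def pair_def n_def)
  qed
  finally show ?thesis .
qed

lemma idx_eq_Nil_iff: "idx m = [] \<longleftrightarrow> m = 0"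
proof -
  have "lead_mon [] = 0" by (simp add: lead_mon_alt mon_def)
  then show ?thesis using lead_mon_idx[of m] idx_lead_mon[of "[]"]
    by (metis Bunion_iff)
qed

lemma pair_Nil: "pair m [] = (if m = 0 then 1 else 0)"
proof (cases "m = 0")
  case True
  then show ?thesis using pair_lead_mon[of "[]"]
    by (simp add: lead_mon_alt mon_def Bunion_iff)
qed (simp add: pair_def idx_eq_Nil_iff)

lemma pr_dmon_Nil: "pr (dmon m) [] = 0"
proof -
  have "m - single i 1 + single (i - 1) 1 \<noteq> 0" for i
  proof
    assume "m - single i 1 + single (i - 1) 1 = 0"
    from arg_cong[OF this, of "\<lambda>x. lookup x (i - 1)"] show False by (simp add: lookup_add)
  qed
  then show ?thesis
    unfolding dmon_def pr_sum by (intro sum.neutral) (auto simp: pair_Nil)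
qed

text \<open>The empty tuple is separate because \<open>raise\<close> fixes it, while a derivative
  has no constant term.\<close>

lemma pr_dA: "b \<in> Bunion \<Longrightarrow> pr (dA p) b = (if b = [] then 0 else pr p (raise b))"
  by (simp add: dA_def pr_sum pr_scale pr_dmon pr_dmon_Nil) (simp add: pr_def lin_ext_def)

lemma B0_subset: "B0 \<subseteq> Bunion"
  by (auto simp: B0_def B0set_def Bunion_iff Bset_iff split: if_splits)

text \<open>For length above 1, being raised means having a positive first entry. For length 1 the
  only entry is also the last one and must stay positive after lowering, so exactly
  \<open>[1]\<close> is not raised.\<close>

lemma raise_image: "raise ` (Bunion - {[]}) = Bunion - B0"
proof (intro antisym subsetI)
  fix c assume "c \<in> raise ` (Bunion - {[]})"
  then obtain b where "b \<in> Bunion" "b \<noteq> []" "c = raise b" by auto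
  then show "c \<in> Bunion - B0"
    by (cases b) (auto simp: raise_def B0_def B0set_def Bunion_iff Bset_iff nth_Cons split: if_splits nat.splits)
next
  fix c assume c: "c \<in> Bunion - B0"
  then obtain x xs where cx: "c = x # xs"
    by (cases c) (auto simp: B0_def B0set_def)
  have *: "c \<notin> B0set (length c)" using c by (auto simp: B0_def)
  have "raise ((x - 1) # xs) = c" "(x - 1) # xs \<in> Bunion"
    using * c by (auto simp: cx raise_def B0set_def Bunion_iff Bset_iff nth_Cons split: if_splits nat.splits)
  then show "c \<in> raise ` (Bunion - {[]})" by force
qed

text \<open>Nondegeneracy turns \<open>dA p = 0\<close> into vanishing pairings, and adjointness
  moves these to the raised tuples, the complement of \<open>B0\<close> in
  \<open>Bunion\<close>.\<close>

lemma Jring_iff: "p \<in> Jring \<longleftrightarrow> keys (phi p) \<subseteq> B0"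
proof -
  have "p \<in> Jring \<longleftrightarrow> (\<forall>b\<in>Bunion. pr (dA p) b = 0)"
    using pr_separates[of "dA p"] by (auto simp: Jring_def)
  also have "\<dots> \<longleftrightarrow> (\<forall>b\<in>Bunion - {[]}. pr p (raise b) = 0)"
    by (auto simp: pr_dA)
  also have "\<dots> \<longleftrightarrow> (\<forall>b\<in>Bunion - B0. pr p b = 0)"
    by (simp flip: raise_image)
  also have "\<dots> \<longleftrightarrow> keys (phi p) \<subseteq> B0"
    by (auto simp: in_keys_iff lookup_phi subset_iff split: if_splits)
  finally show ?thesis .
qed

subsection \<open>The structure constants\<close>

text \<open>An inductive description makes closure under sums and products easy; an explicit
  coefficient function is extracted only once, in \<open>zspan_coefficients\<close>.\<close>

inductive_set zspan :: "'i set \<Rightarrow> ('i \<Rightarrow> 'a::comm_ring_1) \<Rightarrow> 'a set" for P G where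
  zero: "0 \<in> zspan P G"
| step: "x \<in> zspan P G \<Longrightarrow> q \<in> P \<Longrightarrow> x + of_int c * G q \<in> zspan P G"

lemma zspan_base: "q \<in> P \<Longrightarrow> G q \<in> zspan P G"
  using zspan.step[OF zspan.zero, where c = 1] by simp

lemma zspan_add:
  assumes "x \<in> zspan P G" "y \<in> zspan P G"
  shows "x + y \<in> zspan P G"
  using assms(2)
proof (induction rule: zspan.induct)
  case (step y q c)
  then show ?case using zspan.step[of "x + y" P G q c] by (simp add: add.assoc)
qed (simp add: assms(1))

lemma zspan_sum: "(\<And>i. i \<in> I \<Longrightarrow> f i \<in> zspan P G) \<Longrightarrow> sum f I \<in> zspan P G"
  by (induction I rule: infinite_finite_induct) (auto intro: zspan.zero zspan_add)

lemma zspan_mult: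
  assumes "x \<in> zspan P G" "y \<in> zspan P' G"
    and closed: "\<And>q q'. q \<in> P \<Longrightarrow> q' \<in> P' \<Longrightarrow> G q * G q' \<in> G ` P''"
  shows "x * y \<in> zspan P'' G"
  using assms(1)
proof (induction rule: zspan.induct)
  case (step x q c)
  have "of_int c * G q * y \<in> zspan P'' G"
    using assms(2)
  proof (induction rule: zspan.induct)
    case (step y q' c')
    obtain q'' where q'': "q'' \<in> P''" "G q * G q' = G q''" using closed[OF \<open>q \<in> P\<close> \<open>q' \<in> P'\<close>] by auto
    have "of_int c * G q * (y + of_int c' * G q') = of_int c * G q * y + of_int (c * c') * (G q * G q')"
      by (simp add: algebra_simps)
    then show ?case using zspan.step[OF step.IH q''(1), of "c * c'"] q''(2) by simp
  qed (simp add: zspan.zero)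
  with step.IH show ?case by (simp add: distrib_right zspan_add)
qed (simp add: zspan.zero)

lemma zspan_coefficients:
  assumes "x \<in> zspan P G"
  shows "\<exists>f. finite {q. f q \<noteq> 0} \<and> {q. f q \<noteq> 0} \<subseteq> P \<and> x = (\<Sum>q | f q \<noteq> 0. of_int (f q) * G q)"
  using assms
proof (induction rule: zspan.induct)
  case zero
  show ?case by (intro exI[of _ "\<lambda>_. 0"]) simp
next
  case (step x q c)
  then obtain f where f: "finite {q. f q \<noteq> 0}" "{q. f q \<noteq> 0} \<subseteq> P" "x = (\<Sum>q | f q \<noteq> 0. of_int (f q) * G q)"
    by auto
  define f' where "f' = f(q := f q + c)"
  let ?A = "insert q {q. f q \<noteq> 0}"
  have "{q. f' q \<noteq> 0} \<subseteq> ?A" by (auto simp: f'_def)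
  moreover have "(\<Sum>q | f' q \<noteq> 0. of_int (f' q) * G q) = x + of_int c * G q"
  proof -
    have "(\<Sum>q | f' q \<noteq> 0. of_int (f' q) * G q) = (\<Sum>q\<in>?A. of_int (f' q) * G q)"
      using f(1) by (intro sum.mono_neutral_left) (auto simp: f'_def)
    also have "\<dots> = (\<Sum>r\<in>?A. of_int (f r) * G r + (if r = q then of_int c * G q else 0))"
      by (intro sum.cong) (auto simp: f'_def algebra_simps)
    also have "\<dots> = (\<Sum>r\<in>?A. of_int (f r) * G r) + of_int c * G q"
      using f(1) by (simp add: sum.distrib del: sum.insert)
    also have "(\<Sum>r\<in>?A. of_int (f r) * G r) = x"
      unfolding f(3) using f(1) by (intro sum.mono_neutral_right) auto
    finally show ?thesis .
  qed
  ultimately show ?case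
    using f step.hyps by (intro exI[of _ f']) (auto intro: finite_subset)
qed

section \<open>Splitting the variables into two groups\<close>

lemma esym_union:
  assumes fin: "finite V" "finite V'" and disj: "V \<inter> V' = {}"
  shows "esym (V \<union> V') n = (\<Sum>i\<le>n. esym V i * esym V' (n - i))"
proof -
  \<comment> \<open>A subset of the union is recorded by its two traces; grouping by the size of the
    first trace gives the convolution.\<close>
  let ?D = "{p \<in> Pow V \<times> Pow V'. card (fst p) + card (snd p) = n}"
  have ind: "ind (S \<union> S') = ind S + ind S'" if "S \<subseteq> V" "S' \<subseteq> V'" for S S'
    unfolding ind_def using that fin disj by (intro sum.union_disjoint) (auto intro: finite_subset)
  have cardU: "card (S \<union> S') = card S + card S'" if "S \<subseteq> V" "S' \<subseteq> V'" for S S'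
    using that fin disj by (intro card_Un_disjoint) (auto intro: finite_subset)
  have "esym (V \<union> V') n = (\<Sum>p\<in>?D. single (ind (fst p \<union> snd p)) 1)"
    unfolding esym_eq
  proof (rule sum.reindex_bij_witness[of _ "\<lambda>p. fst p \<union> snd p" "\<lambda>S. (S \<inter> V, S \<inter> V')"])
    fix S assume "S \<in> {S. S \<subseteq> V \<union> V' \<and> card S = n}"
    then have S: "S \<inter> V \<union> S \<inter> V' = S" "card S = n" by auto
    then show "fst (S \<inter> V, S \<inter> V') \<union> snd (S \<inter> V, S \<inter> V') = S"
      "single (ind (fst (S \<inter> V, S \<inter> V') \<union> snd (S \<inter> V, S \<inter> V'))) 1 = single (ind S) 1"
      "(S \<inter> V, S \<inter> V') \<in> ?D"
      using cardU[of "S \<inter> V" "S \<inter> V'"] by simp_all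
  next
    fix p assume p: "p \<in> ?D"
    then show "((fst p \<union> snd p) \<inter> V, (fst p \<union> snd p) \<inter> V') = p"
      using disj by (cases p) auto
    show "fst p \<union> snd p \<in> {S. S \<subseteq> V \<union> V' \<and> card S = n}"
      using p cardU[of "fst p" "snd p"] by auto
  qed
  also have "\<dots> = (\<Sum>i\<le>n. \<Sum>p | p \<in> ?D \<and> card (fst p) = i. single (ind (fst p \<union> snd p)) 1)"
    using fin by (intro sum.group[symmetric]) (auto intro!: finite_subset[of _ "Pow V \<times> Pow V'"])
  also have "\<dots> = (\<Sum>i\<le>n. esym V i * esym V' (n - i))"
  proof (rule sum.cong[OF refl])
    fix i assume "i \<in> {..n}"
    then have D: "{p. p \<in> ?D \<and> card (fst p) = i} = {S. S \<subseteq> V \<and> card S = i} \<times> {S. S \<subseteq> V' \<and> card S = n - i}"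
      by auto
    show "(\<Sum>p | p \<in> ?D \<and> card (fst p) = i. single (ind (fst p \<union> snd p)) 1) = esym V i * esym V' (n - i)"
      unfolding D esym_eq sum_product sum.cartesian_product
      by (intro sum.cong) (auto simp: mult_single ind)
  qed
  finally show ?thesis .
qed

lemma esym_zero: "finite V \<Longrightarrow> esym V 0 = 1"
proof -
  assume "finite V"
  then have "{S. S \<subseteq> V \<and> card S = 0} = {{}}" by (auto dest: finite_subset)
  then show ?thesis by (simp add: esym_eq ind_def)
qed

lemma esym_gt_card:
  assumes "finite V" "card V < i"
  shows "esym V i = 0"
proof -
  have "{S. S \<subseteq> V \<and> card S = i} = {}"
    using assms(2) by (auto dest: card_mono[OF assms(1)])
  then show ?thesis by (simp only: esym_eq sum.empty)
qed

text \<open>The exponent tuple of a single elementary symmetric polynomial. Position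
  \<open>i - 1\<close> belongs to degree \<open>i\<close>, and the zero tuple represents the degree
  0 case, where \<open>esym\<close> is 1.\<close>

definition unit_list :: "nat \<Rightarrow> nat \<Rightarrow> nat list" where
  "unit_list l i = (if i = 0 then replicate l 0 else (replicate l 0)[i - 1 := 1])"

lemma length_unit_list [simp]: "length (unit_list l i) = l"
  by (simp add: unit_list_def)

lemma emon_unit_list:
  assumes "finite V" "i \<le> l"
  shows "emon V (unit_list l i) = esym V i"
proof (cases "i = 0")
  case False
  have "emon V (unit_list l i) = (\<Prod>j<l. if j = i - 1 then esym V i else 1)"
    unfolding emon_def using False assms(2) by (intro prod.cong) (auto simp: unit_list_def nth_list_update)
  also have "\<dots> = esym V i" using less_le_trans[OF diff_less[of 1 i] assms(2)] False by simp
  finally show ?thesis .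
qed (use assms(1) in \<open>simp add: unit_list_def emon_def esym_zero\<close>)

lemma emon_mult:
  assumes "length b = length c"
  shows "emon V b * emon V c = emon V (map2 (+) b c)"
  using assms by (auto simp: emon_def power_add simp flip: prod.distrib intro!: prod.cong)

definition emon2 :: "nat \<Rightarrow> nat \<Rightarrow> nat list \<times> nat list \<Rightarrow> Kpoly" where
  "emon2 l l' q = emon (kvars l) (fst q) * emon (kpvars l') (snd q)"

text \<open>Unlike \<open>Bset\<close>, zero last entries are allowed: the factors of
  \<open>emon\<close> over the union need not be divisible by the product of all variables.\<close>

definition lists_of_length :: "nat \<Rightarrow> nat list set" where
  "lists_of_length l = {b. length b = l}"

lemma emon2_mult:
  assumes "q \<in> lists_of_length l \<times> lists_of_length l'" "q' \<in> lists_of_length l \<times> lists_of_length l'"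
  shows "emon2 l l' q * emon2 l l' q' = emon2 l l' (map2 (+) (fst q) (fst q'), map2 (+) (snd q) (snd q'))"
proof -
  have "emon2 l l' q * emon2 l l' q' = (emon (kvars l) (fst q) * emon (kvars l) (fst q'))
      * (emon (kpvars l') (snd q) * emon (kpvars l') (snd q'))"
    by (simp add: emon2_def ac_simps)
  also have "\<dots> = emon2 l l' (map2 (+) (fst q) (fst q'), map2 (+) (snd q) (snd q'))"
    using assms by (auto simp: emon2_def emon_mult lists_of_length_def)
  finally show ?thesis .
qed

lemma disjoint_vars: "kvars l \<inter> kpvars l' = {}"
  by (auto simp: kvars_def kpvars_def)

lemma one_in_span: "1 \<in> zspan (lists_of_length l \<times> lists_of_length l') (emon2 l l')"
proof -
  have "emon2 l l' (unit_list l 0, unit_list l' 0) = 1"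
    by (simp add: emon2_def emon_unit_list esym_zero)
  then show ?thesis
    using zspan_base[of "(unit_list l 0, unit_list l' 0)" "lists_of_length l \<times> lists_of_length l'" "emon2 l l'"]
    by (simp add: lists_of_length_def)
qed

lemma mult_in_span:
  assumes "x \<in> zspan (lists_of_length l \<times> lists_of_length l') (emon2 l l')" "y \<in> zspan (lists_of_length l \<times> lists_of_length l') (emon2 l l')"
  shows "x * y \<in> zspan (lists_of_length l \<times> lists_of_length l') (emon2 l l')"
  using assms by (rule zspan_mult) (auto simp: emon2_mult lists_of_length_def intro!: imageI)

lemma esym_union_in_span:
  "esym (kvars l \<union> kpvars l') n \<in> zspan (lists_of_length l \<times> lists_of_length l') (emon2 l l')"
proof -
  have "esym (kvars l) i * esym (kpvars l') j \<in> zspan (lists_of_length l \<times> lists_of_length l') (emon2 l l')" for i j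
  proof (cases "i \<le> l \<and> j \<le> l'")
    case True
    then have "emon2 l l' (unit_list l i, unit_list l' j) = esym (kvars l) i * esym (kpvars l') j"
      by (simp add: emon2_def emon_unit_list)
    then show ?thesis
      using zspan_base[of "(unit_list l i, unit_list l' j)" "lists_of_length l \<times> lists_of_length l'" "emon2 l l'"]
      by (simp add: lists_of_length_def)
  next
    case False
    then have "esym (kvars l) i * esym (kpvars l') j = 0"
      by (auto simp: not_le esym_gt_card)
    then show ?thesis by (simp only: zspan.zero)
  qed
  then show ?thesis by (simp add: esym_union disjoint_vars zspan_sum)
qed

lemma emon_union_in_span:
  "emon (kvars l \<union> kpvars l') b \<in> zspan (lists_of_length l \<times> lists_of_length l') (emon2 l l')"
  by (rule emon_rel_induct[where Q = "\<lambda>f _. f \<in> zspan (lists_of_length l \<times> lists_of_length l') (emon2 l l')", OF refl])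
     (auto intro: one_in_span mult_in_span esym_union_in_span)

lemma map2_unit_list_in_Bset:
  assumes "length b = l"
  shows "map2 (+) (unit_list l l) b \<in> Bset l"
proof -
  have "map2 (+) (unit_list l l) b ! (l - 1) \<ge> 1" if "l \<noteq> 0"
    using that assms by (simp add: nth_list_update unit_list_def del: replicate_Suc)
  then show ?thesis using assms by (auto simp: Bset_def)
qed

text \<open>The positive last entry of \<open>b\<close> provides the product of all variables as a
  factor. It is the product of the top elementary symmetric polynomials of the two groups, so it
  makes both last entries positive and carries the span of plain tuples into that of
  \<open>Bset l \<times> Bset l'\<close>.\<close>

lemma emon_union_in_Bspan:
  assumes "b \<in> Bset (l + l')"
  shows "emon (kvars l \<union> kpvars l') b \<in> zspan (Bset l \<times> Bset l') (emon2 l l')"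
proof (cases "b = []")
  case True
  then have "l = 0" "l' = 0" using assms by (auto simp: Bset_iff)
  then show ?thesis
    using True zspan_base[of "([], [])" "Bset l \<times> Bset l'" "emon2 l l'"]
    by (simp add: emon2_def emon_def Bset_def)
next
  case False
  let ?U = "kvars l \<union> kpvars l'"
  let ?t = "(unit_list l l, unit_list l' l')"
  have len: "length b = l + l'" and b: "b \<in> Bunion" using assms by (auto simp: Bset_iff Bunion_iff)
  have cU: "card ?U = l + l'" by (simp add: card_Un_disjoint disjoint_vars)
  have "ind ?U = ind (kvars l) + ind (kpvars l')"
    unfolding ind_def by (intro sum.union_disjoint) (auto simp: disjoint_vars)
  then have "esym ?U (l + l') = emon2 l l' ?t"
    using esym_card[of ?U] esym_card[of "kvars l"] esym_card[of "kpvars l'"]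
    by (simp add: cU emon2_def emon_unit_list mult_single)
  then have eq: "emon ?U b = emon2 l l' ?t * emon ?U (b[length b - 1 := b ! (length b - 1) - 1])"
    using emon_last[OF b False] len by simp
  have "emon2 l l' ?t \<in> zspan {?t} (emon2 l l')" by (rule zspan_base) simp
  then show ?thesis unfolding eq
  proof (rule zspan_mult[OF _ emon_union_in_span])
    fix q q' assume "q \<in> {?t}" "q' \<in> lists_of_length l \<times> lists_of_length l'"
    then show "emon2 l l' q * emon2 l l' q' \<in> emon2 l l' ` (Bset l \<times> Bset l')"
      by (subst emon2_mult) (auto simp: lists_of_length_def intro!: imageI map2_unit_list_in_Bset)
  qed
qed

text \<open>Names the condition under \<open>THE\<close> in \<open>Ncoef\<close>, so that existence
  and uniqueness can be treated separately.\<close>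

definition is_coef :: "nat \<Rightarrow> nat \<Rightarrow> nat list \<Rightarrow> (nat list \<times> nat list \<Rightarrow> int) \<Rightarrow> bool" where
  "is_coef l l' b'' f \<longleftrightarrow>
      (\<forall>b b'. f (b, b') \<noteq> 0 \<longrightarrow> b \<in> Bset l \<and> b' \<in> Bset l') \<and>
      finite {q. f q \<noteq> 0} \<and>
      emon (kvars l \<union> kpvars l') b'' =
        (\<Sum>q\<in>{q. f q \<noteq> 0}. of_int (f q) * emon (kvars l) (fst q) * emon (kpvars l') (snd q))"

lemma exists_coef:
  assumes "b'' \<in> Bset (l + l')"
  shows "\<exists>f. is_coef l l' b'' f"
proof -
  obtain f where "finite {q. f q \<noteq> 0}" "{q. f q \<noteq> 0} \<subseteq> Bset l \<times> Bset l'"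
    "emon (kvars l \<union> kpvars l') b'' = (\<Sum>q | f q \<noteq> 0. of_int (f q) * emon2 l l' q)"
    using zspan_coefficients[OF emon_union_in_Bspan[OF assms]] by auto
  then have "is_coef l l' b'' f"
    by (auto simp: is_coef_def emon2_def mult.assoc)
  then show ?thesis by blast
qed

lemma keys_emon:
  assumes V: "finite V" and m: "m \<in> keys (emon V b)"
  shows "keys m \<subseteq> V"
proof -
  have "\<forall>m\<in>keys (emon V b). keys m \<subseteq> V"
  proof (rule emon_rel_induct[where Q = "\<lambda>f _. \<forall>m\<in>keys f. keys m \<subseteq> V", OF refl])
    fix i and f f' :: Kpoly assume f: "\<forall>m\<in>keys f. keys m \<subseteq> V"
    show "\<forall>m\<in>keys (esym V (Suc i) * f). keys m \<subseteq> V"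
    proof
      fix m assume "m \<in> keys (esym V (Suc i) * f)"
      then obtain a c where m: "m = a + c" "a \<in> keys (esym V (Suc i))" "c \<in> keys f"
        using keys_mult by blast
      have "keys a \<subseteq> V"
        by (rule keys_esym[OF m(2)]) (metis V finite_subset keys_ind)
      then show "keys m \<subseteq> V" using m(1) f m(3) keys_add[of a c] by blast
    qed
  qed simp
  then show ?thesis using m by blast
qed

text \<open>An exponent on the union splits uniquely into its parts on \<open>V\<close> and
  \<open>V'\<close>, so just one pair of terms can contribute.\<close>

lemma lookup_mult_disjoint:
  fixes f g :: Kpoly
  assumes f: "\<And>m. m \<in> keys f \<Longrightarrow> keys m \<subseteq> V" and g: "\<And>m. m \<in> keys g \<Longrightarrow> keys m \<subseteq> V'"
    and disj: "V \<inter> V' = {}" and \<kappa>: "keys \<kappa> \<subseteq> V" "keys \<kappa>' \<subseteq> V'"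
  shows "lookup (f * g) (\<kappa> + \<kappa>') = lookup f \<kappa> * lookup g \<kappa>'"
proof -
  have split: "m = \<kappa> \<and> m' = \<kappa>'" if "keys m \<subseteq> V" "keys m' \<subseteq> V'" "m + m' = \<kappa> + \<kappa>'" for m m'
  proof -
    have "lookup m v = lookup \<kappa> v \<and> lookup m' v = lookup \<kappa>' v" for v
    proof -
      have z: "lookup a v = 0" if "keys a \<subseteq> W" "v \<notin> W" for a :: "nat + nat \<Rightarrow>\<^sub>0 nat" and W
        using that by (meson in_keys_iff subsetD)
      have "lookup m v + lookup m' v = lookup \<kappa> v + lookup \<kappa>' v"
        using arg_cong[OF that(3), of "\<lambda>x. lookup x v"] by (simp add: lookup_add)
      moreover have "v \<notin> V \<or> v \<notin> V'" using disj by blast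
      ultimately show ?thesis
        using z[OF that(1)] z[OF that(2)] z[OF \<kappa>(1)] z[OF \<kappa>(2)] by fastforce
    qed
    then show ?thesis by (auto intro: poly_mapping_eqI)
  qed
  have "lookup (f * g) (\<kappa> + \<kappa>') = (\<Sum>m\<in>keys f. \<Sum>m'\<in>keys g.
      if m' = \<kappa>' then (if m = \<kappa> then lookup f m * lookup g m' else 0) else 0)"
    unfolding lookup_mult_expand
  proof (intro sum.cong refl)
    fix m m' assume "m \<in> keys f" "m' \<in> keys g"
    then have "m + m' = \<kappa> + \<kappa>' \<longleftrightarrow> m' = \<kappa>' \<and> m = \<kappa>"
      using split[of m m'] f g by blast
    then show "(if m + m' = \<kappa> + \<kappa>' then lookup f m * lookup g m' else 0) =
        (if m' = \<kappa>' then (if m = \<kappa> then lookup f m * lookup g m' else 0) else 0)" by simp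
  qed
  also have "\<dots> = (\<Sum>m\<in>keys f. if m = \<kappa> then lookup f m * lookup g \<kappa>' else 0)"
    by (intro sum.cong refl) (auto simp: in_keys_iff)
  also have "\<dots> = lookup f \<kappa> * lookup g \<kappa>'"
    by (auto simp: in_keys_iff)
  finally show ?thesis .
qed

text \<open>Transports the canonical exponent of \<open>m\<close> to any set of the right size, in
  particular to the primed variables.\<close>

lemma exists_exponent:
  assumes V: "finite V" "card V = length (idx m)"
  shows "\<exists>\<kappa>. keys \<kappa> = V \<and> xmon V \<kappa> = m"
proof -
  let ?b = "idx m"
  obtain h where h: "bij_betw h V (kvars (length ?b))"
    using V finite_same_card_bij[of V "kvars (length ?b)"] by auto
  define \<kappa> where "\<kappa> = (\<Sum>v\<in>V. single v (lookup (lead ?b) (h v)))"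
  have \<kappa>: "lookup \<kappa> v = (if v \<in> V then lookup (lead ?b) (h v) else 0)" for v
    using V(1) by (simp add: \<kappa>_def lookup_sum lookup_single when_def)
  have "lookup (lead ?b) (h v) \<noteq> 0" if "v \<in> V" for v
    using that h keys_lead[OF idx_in, of m] by (metis bij_betw_apply in_keys_iff)
  then have "keys \<kappa> = V" by (auto simp: in_keys_iff \<kappa> split: if_splits)
  moreover have "xmon V \<kappa> = m"
  proof -
    have "image_mset (\<lambda>v. lookup \<kappa> v - 1) (mset_set V)
        = image_mset (\<lambda>v. lookup (lead ?b) (h v) - 1) (mset_set V)"
      using V(1) by (intro image_mset_cong) (simp add: \<kappa>)
    also have "\<dots> = image_mset (\<lambda>v. lookup (lead ?b) v - 1) (image_mset h (mset_set V))"
      by (simp add: multiset.map_comp comp_def)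
    also have "image_mset h (mset_set V) = mset_set (kvars (length ?b))"
      using h by (simp add: image_mset_mset_set bij_betw_def)
    finally have "xmon V \<kappa> = lead_mon ?b" by (simp only: xmon_def lead_mon_def)
    then show ?thesis by simp
  qed
  ultimately show ?thesis by blast
qed

text \<open>Realise \<open>m\<close> on the unprimed and \<open>m'\<close> on the primed variables;
  then \<open>\<kappa> + \<kappa>'\<close> represents \<open>m + m'\<close>. The formula reads the
  coefficient at \<open>\<kappa> + \<kappa>'\<close> on both sides of the identity in
  \<open>is_coef\<close>.\<close>

lemma length_idx_add: "length (idx (m + m')) = length (idx m) + length (idx m')"
  and pair_add_coef: "is_coef (length (idx m)) (length (idx m')) b'' f \<Longrightarrow>
    length b'' = length (idx m) + length (idx m') \<Longrightarrow>
    pair (m + m') b'' = (\<Sum>q | f q \<noteq> 0. f q * pair m (fst q) * pair m' (snd q))"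
proof -
  define l l' where "l = length (idx m)" and "l' = length (idx m')"
  obtain \<kappa> where \<kappa>: "keys \<kappa> = kvars l" "xmon (kvars l) \<kappa> = m"
    using exists_exponent[of "kvars l" m] by (auto simp: l_def)
  obtain \<kappa>' where \<kappa>': "keys \<kappa>' = kpvars l'" "xmon (kpvars l') \<kappa>' = m'"
    using exists_exponent[of "kpvars l'" m'] by (auto simp: l'_def)
  let ?U = "kvars l \<union> kpvars l'"
  have mm: "xmon ?U (\<kappa> + \<kappa>') = m + m'"
    using xmon_union[of "kvars l" "kpvars l'" \<kappa> \<kappa>'] \<kappa> \<kappa>' by (simp add: disjoint_vars)
  have cU: "card ?U = l + l'" by (simp add: card_Un_disjoint disjoint_vars)
  have "keys (\<kappa> + \<kappa>') = keys \<kappa> \<union> keys \<kappa>'"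
    by (auto simp: in_keys_iff lookup_add)
  then have keysU: "keys (\<kappa> + \<kappa>') = ?U" by (simp add: \<kappa> \<kappa>')
  show "length (idx (m + m')) = length (idx m) + length (idx m')"
    using length_idx_xmon[of ?U "\<kappa> + \<kappa>'"] by (simp add: mm cU flip: l_def l'_def)
  assume f: "is_coef (length (idx m)) (length (idx m')) b'' f"
    and len: "length b'' = length (idx m) + length (idx m')"
  have scale: "lookup (of_int c * h) k = c * lookup h k" for c and h :: Kpoly and k
  proof -
    have "of_int c = (single 0 c :: Kpoly)" unfolding single_of_int[symmetric] by simp
    then show ?thesis using lookup_single_mult_add[of 0 c h k] by simp
  qed
  have "pair (m + m') b'' = lookup (emon ?U b'') (\<kappa> + \<kappa>')"
    using pair_xmon[of ?U "\<kappa> + \<kappa>'" b''] len by (simp add: mm cU keysU flip: l_def l'_def)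
  also have "\<dots> = (\<Sum>q | f q \<noteq> 0. f q * lookup (emon (kvars l) (fst q) * emon (kpvars l') (snd q)) (\<kappa> + \<kappa>'))"
    using f by (simp add: is_coef_def lookup_sum scale mult.assoc flip: l_def l'_def)
  also have "\<dots> = (\<Sum>q | f q \<noteq> 0. f q * pair m (fst q) * pair m' (snd q))"
  proof (rule sum.cong[OF refl])
    fix q assume "q \<in> {q. f q \<noteq> 0}"
    then have "length (fst q) = l" "length (snd q) = l'"
      using f by (cases q, auto simp: is_coef_def Bset_iff l_def l'_def)+
    then have "pair m (fst q) = lookup (emon (kvars l) (fst q)) \<kappa>"
      "pair m' (snd q) = lookup (emon (kpvars l') (snd q)) \<kappa>'"
      using pair_xmon[of "kvars l" \<kappa> "fst q"] pair_xmon[of "kpvars l'" \<kappa>' "snd q"] \<kappa> \<kappa>' by auto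
    moreover have "lookup (emon (kvars l) (fst q) * emon (kpvars l') (snd q)) (\<kappa> + \<kappa>')
        = lookup (emon (kvars l) (fst q)) \<kappa> * lookup (emon (kpvars l') (snd q)) \<kappa>'"
      by (rule lookup_mult_disjoint[OF keys_emon[OF finite_kvars] keys_emon[OF finite_kpvars] disjoint_vars])
         (use \<kappa>(1) \<kappa>'(1) in blast)+
    ultimately show "f q * lookup (emon (kvars l) (fst q) * emon (kpvars l') (snd q)) (\<kappa> + \<kappa>')
        = f q * pair m (fst q) * pair m' (snd q)"
      by simp
  qed
  finally show "pair (m + m') b'' = (\<Sum>q | f q \<noteq> 0. f q * pair m (fst q) * pair m' (snd q))" .
qed

text \<open>One finite index set that works for every monomial of \<open>p\<close> at once, which
  allows sums to be exchanged. It can exceed \<open>keys (phi p)\<close>, since pairings of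
  different monomials may cancel.\<close>

definition supp :: "Apoly \<Rightarrow> nat list set" where
  "supp p = (\<Union>m\<in>keys p. {b\<in>Bunion. pair m b \<noteq> 0})"

lemma finite_supp [simp]: "finite (supp p)"
  by (simp add: supp_def finite_pair_support)

lemma supp_subset: "supp p \<subseteq> Bunion"
  by (auto simp: supp_def)

lemma pair_add_supp:
  assumes m: "m \<in> keys p" "m' \<in> keys q"
    and f: "is_coef (length (idx m)) (length (idx m')) b'' f"
    and len: "length b'' = length (idx m) + length (idx m')"
  shows "pair (m + m') b'' = (\<Sum>b\<in>supp p. \<Sum>b'\<in>supp q. f (b, b') * pair m b * pair m' b')"
proof -
  have "pair (m + m') b'' = (\<Sum>q | f q \<noteq> 0. f q * pair m (fst q) * pair m' (snd q))"
    using f len by (rule pair_add_coef)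
  also have "\<dots> = (\<Sum>r\<in>supp p \<times> supp q. f r * pair m (fst r) * pair m' (snd r))"
  proof (rule sum.mono_neutral_cong)
    show "finite {q. f q \<noteq> 0}" using f by (simp add: is_coef_def)
    fix r assume r: "r \<in> {q. f q \<noteq> 0} - supp p \<times> supp q"
    then have "fst r \<in> Bunion" "snd r \<in> Bunion"
      using f by (cases r, auto simp: is_coef_def Bunion_def)+
    then show "f r * pair m (fst r) * pair m' (snd r) = 0"
      using r m by (cases r) (auto simp: supp_def)
  qed auto
  also have "\<dots> = (\<Sum>b\<in>supp p. \<Sum>b'\<in>supp q. f (b, b') * pair m b * pair m' b')"
    by (simp add: sum.cartesian_product case_prod_unfold)
  finally show ?thesis .
qed

lemma bilinear_sum_swap:
  fixes C :: "'b \<Rightarrow> 'c \<Rightarrow> 'a::comm_semiring_1"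
  shows "(\<Sum>m\<in>M. \<Sum>m'\<in>M'. u m * v m' * (\<Sum>b\<in>B. \<Sum>b'\<in>B'. C b b' * X m b * Y m' b'))
    = (\<Sum>b\<in>B. \<Sum>b'\<in>B'. C b b' * (\<Sum>m\<in>M. u m * X m b) * (\<Sum>m'\<in>M'. v m' * Y m' b'))"
    (is "?l = ?r")
proof -
  let ?t = "\<lambda>m m' b b'. u m * v m' * (C b b' * X m b * Y m' b')"
  have "?l = (\<Sum>m\<in>M. \<Sum>m'\<in>M'. \<Sum>b\<in>B. \<Sum>b'\<in>B'. ?t m m' b b')"
    by (simp only: sum_distrib_left)
  also have "\<dots> = (\<Sum>m\<in>M. \<Sum>b\<in>B. \<Sum>m'\<in>M'. \<Sum>b'\<in>B'. ?t m m' b b')"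
    by (intro sum.cong refl sum.swap)
  also have "\<dots> = (\<Sum>b\<in>B. \<Sum>m\<in>M. \<Sum>m'\<in>M'. \<Sum>b'\<in>B'. ?t m m' b b')"
    by (rule sum.swap)
  also have "\<dots> = (\<Sum>b\<in>B. \<Sum>m\<in>M. \<Sum>b'\<in>B'. \<Sum>m'\<in>M'. ?t m m' b b')"
    by (intro sum.cong refl sum.swap)
  also have "\<dots> = (\<Sum>b\<in>B. \<Sum>b'\<in>B'. \<Sum>m\<in>M. \<Sum>m'\<in>M'. ?t m m' b b')"
    by (intro sum.cong refl sum.swap)
  also have "\<dots> = ?r"
  proof (intro sum.cong refl)
    fix b b'
    have "C b b' * (\<Sum>m\<in>M. u m * X m b) * (\<Sum>m'\<in>M'. v m' * Y m' b')
        = C b b' * (\<Sum>m\<in>M. \<Sum>m'\<in>M'. (u m * X m b) * (v m' * Y m' b'))"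
      by (simp only: mult.assoc[of "C b b'"] sum_product)
    also have "\<dots> = (\<Sum>m\<in>M. \<Sum>m'\<in>M'. ?t m m' b b')"
      unfolding sum_distrib_left by (intro sum.cong refl) (simp add: ac_simps)
    finally show "(\<Sum>m\<in>M. \<Sum>m'\<in>M'. ?t m m' b b') =
        C b b' * (\<Sum>m\<in>M. u m * X m b) * (\<Sum>m'\<in>M'. v m' * Y m' b')" ..
  qed
  finally show ?thesis .
qed

lemma pr_alt: "pr p b = (\<Sum>m\<in>keys p. lookup p m * of_int (pair m b))"
  by (simp add: pr_def lin_ext_def)

text \<open>Pairing with dual bases expresses a coefficient function in terms of the left-hand side of
  its defining identity alone, hence its uniqueness.\<close>

lemma coef_recovered:
  assumes f: "is_coef l l' b'' f" and b'': "length b'' = l + l'"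
    and c: "c \<in> Bset l" "c' \<in> Bset l'"
  shows "of_int (f (c, c')) = (\<Sum>m\<in>keys (dual c). \<Sum>m'\<in>keys (dual c'). lookup (dual c) m * lookup (dual c') m' *
      of_int (if length (idx m) = l \<and> length (idx m') = l' then pair (m + m') b'' else 0))" (is "_ = ?rhs")
proof -
  have "?rhs = (\<Sum>m\<in>keys (dual c). \<Sum>m'\<in>keys (dual c'). lookup (dual c) m * lookup (dual c') m' *
      (\<Sum>b\<in>supp (dual c). \<Sum>b'\<in>supp (dual c'). of_int (f (b, b')) * of_int (pair m b) * of_int (pair m' b')))"
  proof (intro sum.cong refl arg_cong[of _ _ "(*) _"])
    fix m m' assume m: "m \<in> keys (dual c)" "m' \<in> keys (dual c')"
    have "(if length (idx m) = l \<and> length (idx m') = l' then pair (m + m') b'' else 0) =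
        (\<Sum>b\<in>supp (dual c). \<Sum>b'\<in>supp (dual c'). f (b, b') * pair m b * pair m' b')"
    proof (cases "length (idx m) = l \<and> length (idx m') = l'")
      case True
      then show ?thesis using pair_add_supp[OF m, of b'' f] f b'' by simp
    next
      \<comment> \<open>Here all summands vanish: a nonzero pairing forces equal lengths, and
        \<open>f\<close> lives on tuples of lengths \<open>l\<close> and \<open>l'\<close>.\<close>
      case False
      have "f (b, b') * pair m b * pair m' b' = 0" for b b'
      proof (rule ccontr)
        assume "f (b, b') * pair m b * pair m' b' \<noteq> 0"
        then have "f (b, b') \<noteq> 0" "length b = length (idx m)" "length b' = length (idx m')"
          using pair_length by auto
        then show False using f False by (auto simp: is_coef_def Bset_iff)
      qed
      then show ?thesis by (simp only: if_not_P[OF False] sum.neutral_const)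
    qed
    then show "of_int (if length (idx m) = l \<and> length (idx m') = l' then pair (m + m') b'' else 0)
        = (\<Sum>b\<in>supp (dual c). \<Sum>b'\<in>supp (dual c'). of_int (f (b, b')) * of_int (pair m b) * (of_int (pair m' b') :: complex))"
      by (simp only: of_int_sum of_int_mult)
  qed
  also have "\<dots> = (\<Sum>b\<in>supp (dual c). \<Sum>b'\<in>supp (dual c'). of_int (f (b, b')) * pr (dual c) b * pr (dual c') b')"
    by (simp only: bilinear_sum_swap pr_alt)
  also have "\<dots> = (\<Sum>b\<in>supp (dual c). \<Sum>b'\<in>supp (dual c'). if b' = c' then (if b = c then of_int (f (c, c')) else 0) else 0)"
  proof (intro sum.cong refl)
    fix b b' assume "b \<in> supp (dual c)" "b' \<in> supp (dual c')"
    then have "b \<in> Bunion" "b' \<in> Bunion" "c \<in> Bunion" "c' \<in> Bunion"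
      using supp_subset c by (auto simp: Bunion_def)
    then show "of_int (f (b, b')) * pr (dual c) b * pr (dual c') b'
        = (if b' = c' then (if b = c then of_int (f (c, c')) else 0) else 0)"
      by (simp add: pr_dual)
  qed
  also have "\<dots> = of_int (f (c, c'))"
  proof -
    have "c \<in> supp (dual c)" if "c \<in> Bunion" for c
    proof -
      have "pr (dual c) c \<noteq> 0" using that by (simp add: pr_dual)
      then show ?thesis using that
        by (force simp: pr_alt supp_def elim!: sum.not_neutral_contains_not_neutral)
    qed
    then have "c \<in> supp (dual c)" "c' \<in> supp (dual c')" using c by (auto simp: Bunion_def)
    then show ?thesis by simp
  qed
  finally show ?thesis ..
qed

lemma is_coef_unique:
  assumes "is_coef l l' b'' f" "is_coef l l' b'' g" "length b'' = l + l'"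
  shows "f = g"
proof
  fix q :: "nat list \<times> nat list"
  obtain c c' where q: "q = (c, c')" by (cases q)
  show "f q = g q"
  proof (cases "c \<in> Bset l \<and> c' \<in> Bset l'")
    case True
    then have "(of_int (f q) :: complex) = of_int (g q)"
      using coef_recovered[OF assms(1,3)] coef_recovered[OF assms(2,3)] by (simp only: q)
    then show ?thesis by simp
  next
    case False
    then have "f q = 0" "g q = 0" using assms(1,2) unfolding is_coef_def q by blast+
    then show ?thesis by simp
  qed
qed

lemma is_coef_Ncoef:
  assumes "b'' \<in> Bset (l + l')"
  shows "is_coef l l' b'' (Ncoef l l' b'')"
proof -
  obtain f where "is_coef l l' b'' f" using exists_coef[OF assms] by blast
  then have "is_coef l l' b'' (THE f. is_coef l l' b'' f)"
    using is_coef_unique assms by (intro theI[of "is_coef l l' b''"]) (auto simp: Bset_iff)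
  then show ?thesis by (simp add: Ncoef_def flip: is_coef_def)
qed

text \<open>Bilinear extension of \<open>pair_add_supp\<close>. The coefficients supplied there
  depend on the degrees of the monomials; since a nonzero pairing forces equal lengths, they may be
  replaced by \<open>Nco\<close>, which depends on the tuples alone.\<close>

lemma pr_mult:
  assumes b'': "b'' \<in> Bunion"
  shows "pr (p * q) b'' = (\<Sum>b\<in>supp p. \<Sum>b'\<in>supp q.
    (if length b'' = length b + length b' then of_int (Nco b b' b'') else 0) * pr p b * pr q b')"
proof -
  define C where "C b b' = (if length b'' = length b + length b' then Nco b b' b'' else 0)" for b b'
  have "pr (p * q) b'' = (\<Sum>m\<in>keys p. \<Sum>m'\<in>keys q. lookup p m * lookup q m' * of_int (pair (m + m') b''))"
    by (simp add: pr_def lin_ext_mult)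
  also have "\<dots> = (\<Sum>m\<in>keys p. \<Sum>m'\<in>keys q. lookup p m * lookup q m' *
      (\<Sum>b\<in>supp p. \<Sum>b'\<in>supp q. of_int (C b b') * of_int (pair m b) * of_int (pair m' b')))"
  proof (intro sum.cong refl arg_cong[of _ _ "(*) _"])
    fix m m' assume m: "m \<in> keys p" "m' \<in> keys q"
    let ?l = "length (idx m)" and ?l' = "length (idx m')"
    have "pair (m + m') b'' = (\<Sum>b\<in>supp p. \<Sum>b'\<in>supp q. C b b' * pair m b * pair m' b')"
    proof (cases "length b'' = ?l + ?l'")
      case True
      then have "b'' \<in> Bset (?l + ?l')" using b'' by (simp add: Bset_iff Bunion_iff)
      then have "pair (m + m') b'' = (\<Sum>b\<in>supp p. \<Sum>b'\<in>supp q. Ncoef ?l ?l' b'' (b, b') * pair m b * pair m' b')"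
        using pair_add_supp[OF m is_coef_Ncoef] True by simp
      also have "\<dots> = (\<Sum>b\<in>supp p. \<Sum>b'\<in>supp q. C b b' * pair m b * pair m' b')"
      proof (intro sum.cong refl)
        fix b b'
        show "Ncoef ?l ?l' b'' (b, b') * pair m b * pair m' b' = C b b' * pair m b * pair m' b'"
          using pair_length[of m b] pair_length[of m' b'] True
          by (cases "pair m b = 0"; cases "pair m' b' = 0") (simp_all add: C_def Nco_def)
      qed
      finally show ?thesis .
    next
      case False
      then have z: "pair (m + m') b'' = 0" by (simp add: pair_def length_idx_add)
      have "C b b' * pair m b * pair m' b' = 0" for b b'
        using pair_length[of m b] pair_length[of m' b'] False
        by (cases "pair m b = 0"; cases "pair m' b' = 0") (simp_all add: C_def)
      then show ?thesis by (simp only: z sum.neutral_const)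
    qed
    then show "of_int (pair (m + m') b'') = (\<Sum>b\<in>supp p. \<Sum>b'\<in>supp q.
        of_int (C b b') * of_int (pair m b) * (of_int (pair m' b') :: complex))"
      by (simp only: of_int_sum of_int_mult)
  qed
  also have "\<dots> = (\<Sum>b\<in>supp p. \<Sum>b'\<in>supp q. of_int (C b b') * pr p b * pr q b')"
    by (simp only: bilinear_sum_swap pr_alt)
  finally show ?thesis by (simp add: C_def if_distrib[of of_int] cong: if_cong)
qed

lemma keys_phi_subset_supp: "keys (phi p) \<subseteq> supp p"
  by (force simp: in_keys_iff lookup_phi pr_alt supp_def split: if_splits
      elim!: sum.not_neutral_contains_not_neutral)

subsection \<open>The ring isomorphism\<close>

lemma dA_single: "dA (single m c) = single 0 c * dmon m"
  by (simp add: dA_def)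

lemma dA_add: "dA (p + q) = dA p + dA q"
  unfolding dA_def
  by (rule setsum_keys_plus_distrib[where f = "\<lambda>m c. single 0 c * dmon m"])
     (simp_all add: single_add distrib_right)

lemma dA_sum: "dA (sum f S) = (\<Sum>s\<in>S. dA (f s))"
  by (induction S rule: infinite_finite_induct) (simp_all add: dA_add, simp_all add: dA_def)

lemma dmon_superset:
  assumes "finite A" "keys m \<subseteq> A"
  shows "dmon m = (\<Sum>i\<in>A. if i = 0 then 0 else
    single (m - single i 1 + single (i - 1) 1) (of_nat (lookup m i)))"
  unfolding dmon_def using assms
  by (intro sum.mono_neutral_left) (auto simp: in_keys_iff)

lemma dmon_add: "dmon (m + m') = single m 1 * dmon m' + dmon m * single m' 1"
proof -
  let ?A = "keys m \<union> keys m'"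
  \<comment> \<open>Truncated subtraction commutes with adding \<open>m'\<close> only if
    \<open>i\<close> occurs in \<open>m\<close>. Otherwise the coefficient in \<open>shifted\<close>
    is zero and both sides vanish.\<close>
  have shift: "m + m' - single i 1 + single (i - 1) 1 = m - single i 1 + single (i - 1) 1 + m'"
    if "lookup m i \<noteq> 0" for m m' :: "nat \<Rightarrow>\<^sub>0 nat" and i
  proof -
    have "m + m' - single i 1 = m - single i 1 + m'"
      using that by (intro poly_mapping_eqI) (auto simp: lookup_add lookup_minus lookup_single when_def)
    then show ?thesis by (simp add: ac_simps)
  qed
  have shifted: "single (m + m' - single i 1 + single (i - 1) 1) (of_nat (lookup m i)) =
      single (m - single i 1 + single (i - 1) 1) (of_nat (lookup m i)) * single m' (1::complex)" for m m' :: "nat \<Rightarrow>\<^sub>0 nat" and i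
    using shift[of m i m'] by (cases "lookup m i = 0") (simp_all add: mult_single)
  have "dmon (m + m') = (\<Sum>i\<in>?A. if i = 0 then 0 else
      single (m + m' - single i 1 + single (i - 1) 1) (of_nat (lookup (m + m') i)))"
    by (rule dmon_superset) (use keys_add[of m m'] in auto)
  also have "\<dots> = (\<Sum>i\<in>?A. single m 1 * (if i = 0 then 0 else
        single (m' - single i 1 + single (i - 1) 1) (of_nat (lookup m' i)))
      + (if i = 0 then 0 else
        single (m - single i 1 + single (i - 1) 1) (of_nat (lookup m i))) * single m' 1)"
    using shifted[of m m'] shifted[of m' m]
    by (intro sum.cong refl) (auto simp: lookup_add single_add add.commute[of m' m] mult.commute add.commute)
  also have "\<dots> = single m 1 * dmon m' + dmon m * single m' 1"
    by (simp add: sum.distrib sum_distrib_left sum_distrib_right dmon_superset[of ?A])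
  finally show ?thesis .
qed

lemma dA_mult: "dA (p * q) = p * dA q + dA p * q"
proof -
  have "dA (p * q) = (\<Sum>m\<in>keys p. \<Sum>m'\<in>keys q. single 0 (lookup p m * lookup q m') * dmon (m + m'))"
    by (subst poly_mapping_mult_expand) (simp add: dA_sum dA_single)
  also have "\<dots> = (\<Sum>m\<in>keys p. \<Sum>m'\<in>keys q. single m (lookup p m) * (single 0 (lookup q m') * dmon m'))
      + (\<Sum>m\<in>keys p. \<Sum>m'\<in>keys q. (single 0 (lookup p m) * dmon m) * single m' (lookup q m'))"
    unfolding sum.distrib[symmetric]
  proof (intro sum.cong refl)
    fix m m'
    have eqs: "single 0 (lookup p m * lookup q m') = single (0 :: nat \<Rightarrow>\<^sub>0 nat) (lookup p m) * single 0 (lookup q m')"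
        "single m (lookup p m) = single 0 (lookup p m) * single m 1"
        "single m' (lookup q m') = single 0 (lookup q m') * single m' 1"
      by (simp_all add: mult_single)
    show "single 0 (lookup p m * lookup q m') * dmon (m + m') =
        single m (lookup p m) * (single 0 (lookup q m') * dmon m')
        + single 0 (lookup p m) * dmon m * single m' (lookup q m')"
      unfolding eqs dmon_add by (simp add: distrib_left ac_simps)
  qed
  also have "\<dots> = p * dA q + dA p * q"
    by (simp only: sum_product[symmetric] poly_mapping_sum_single flip: dA_def)
  finally show ?thesis .
qed

lemma Jring_mult: "p \<in> Jring \<Longrightarrow> q \<in> Jring \<Longrightarrow> p * q \<in> Jring"
  by (simp add: Jring_def dA_mult)

lemma B0set_length: "b \<in> B0set l \<Longrightarrow> length b = l"
  by (auto simp: B0set_def Bset_iff split: if_splits)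

text \<open>On \<open>B0\<close> the claim is \<open>pr_mult\<close>. Off \<open>B0\<close> the
  definition of \<open>mulJ\<close> gives zero, and so does \<open>phi (p * q)\<close>, because the
  kernel is closed under products.\<close>

lemma phi_mult:
  assumes J: "p \<in> Jring" "q \<in> Jring"
  shows "phi (p * q) = mulJ (phi p) (phi q)"
proof -
  have "(\<Sum>b\<in>keys (phi p). \<Sum>b'\<in>keys (phi q). if b'' \<in> B0set (length b + length b')
      then lookup (phi p) b * lookup (phi q) b' * of_int (Nco b b' b'') else 0) = lookup (phi (p * q)) b''"
    (is "?lhs = _") for b''
  proof (cases "b'' \<in> B0")
    case True
    then obtain k where k: "b'' \<in> B0set k" by (auto simp: B0_def)
    then have B0set: "b'' \<in> B0set l \<longleftrightarrow> length b'' = l" for l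
      using B0set_length by metis
    have b'': "b'' \<in> Bunion" using True B0_subset by blast
    let ?C = "\<lambda>b b'. if length b'' = length b + length b' then of_int (Nco b b' b'') else (0::complex)"
    have "lookup (phi (p * q)) b'' = (\<Sum>b\<in>supp p. \<Sum>b'\<in>supp q. ?C b b' * pr p b * pr q b')"
      using b'' by (simp add: lookup_phi pr_mult)
    \<comment> \<open>Tuples in \<open>supp q\<close> outside \<open>keys (phi q)\<close> have
      pairing 0 with \<open>q\<close>; the same reduction follows for \<open>p\<close>.\<close>
    also have "\<dots> = (\<Sum>b\<in>supp p. \<Sum>b'\<in>keys (phi q). ?C b b' * pr p b * pr q b')"
      using keys_phi_subset_supp[of q] supp_subset[of q]
      by (intro sum.cong refl sum.mono_neutral_right) (auto simp: in_keys_iff lookup_phi split: if_splits)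
    also have "\<dots> = (\<Sum>b\<in>keys (phi p). \<Sum>b'\<in>keys (phi q). ?C b b' * pr p b * pr q b')"
      using keys_phi_subset_supp[of p] supp_subset[of p]
      by (intro sum.mono_neutral_right) (auto simp: in_keys_iff lookup_phi split: if_splits)
    also have "\<dots> = ?lhs"
      using keys_phi[of p] keys_phi[of q]
      by (intro sum.cong refl) (auto simp: lookup_phi B0set subset_iff)
    finally show ?thesis ..
  next
    case False
    then have "lookup (phi (p * q)) b'' = 0"
      using Jring_mult[OF J] by (auto simp: Jring_iff in_keys_iff subset_iff)
    moreover have "?lhs = 0"
      using False by (intro sum.neutral ballI) (auto simp: B0_def)
    ultimately show ?thesis by simp
  qed
  then show ?thesis by (simp add: mulJ_def)
qed

theorem theorem1p1:
  shows "\<exists>\<phi>. bij_betw \<phi> Jring Jprime \<and>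
    (\<forall>p\<in>Jring. \<forall>q\<in>Jring. \<phi> (p + q) = \<phi> p + \<phi> q \<and> \<phi> (p * q) = mulJ (\<phi> p) (\<phi> q))"
proof (intro exI conjI ballI)
  have "phi ` Jring = Jprime"
  proof -
    \<comment> \<open>Surjectivity of \<open>phi\<close> onto all coefficient families on
      \<open>Bunion\<close> gives preimages, and \<open>Jring_iff\<close> places them in the
      kernel.\<close>
    have "Jprime \<subseteq> range phi" using B0_subset by (auto simp: Jprime_def range_phi)
    then show ?thesis by (auto simp: Jring_iff Jprime_def)
  qed
  then show "bij_betw phi Jring Jprime"
    using inj_phi by (auto simp: bij_betw_def intro: inj_on_subset)
qed (simp_all add: phi_add phi_mult)

end
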